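(* Let $V$ be a superspace of dimension $n|m$, let $1\le k\le n$, and let $T\in \Lambda^k(V)$ be an even multivector with associated space $L_T\subset V$. Then $T$ is simple (i.e. $T=\mathbf u_1\wedge\dots\wedge \mathbf u_k$ for some independent even vectors $\mathbf u_1,\dots,\mathbf u_k\in V$) if and only if $T$ is non-degenerate and $$\mathbf w\wedge T=0\qquad\text{for every } \mathbf w\in L_T .$$
   Context: Conventions. $A$ is a fixed nonzero commutative superalgebra over $\mathbb R$ (coefficients may be odd), and $V$ is a free left $A$-module of rank $n|m$ with homogeneous basis $e_a$, $a\in\{1,\dots,n\}\cup\{\hat1,\dots,\hat m\}$; the parity $\tilde a$ is $0$ for $a\in\{1,\dots,n\}$ ("even indices") and $1$ for $a\in\{\hat 1,\dots,\hat m\}$ ("odd indices"). The exterior algebra is $\Lambda(V)=\bigoplus_k\Lambda^k(V)=T(V)/\langle v\otimes w+(-1)^{\tilde v\tilde w}w\otimes v\rangle$ ($T(V)$ the tensor algebra, $v,w$ homogeneous). Every even $T\in\Lambda^k(V)$ is written $T=T^{a_1\dots a_k}e_{a_1}\wedge\dots\wedge e_{a_k}$ (summation over all index values), where $T^{a_1\dots a_k}\in A$ has parity $\tilde a_1+\dots+\tilde a_k$ and $T^{a_1\dots a_ia_{i+1}\dots a_k}=-(-1)^{\tilde a_i\tilde a_{i+1}}T^{a_1\dots a_{i+1}a_i\dots a_k}$. It is regarded as the multilinear function of $k$ covectors given by the tensor $T^{a_1\dots a_k}e_{a_1}\otimes\dots\otimes e_{a_k}$: for homogeneous covectors $p^i\in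 V^*$ with components $p^i_a=e_a(p^i)$, $$T(p^1,\dots,p^k)=T^{a_1\dots a_k}p^1_{a_1}\cdots p^k_{a_k}(-1)^{\tilde p^1(\tilde a_2+\dots+\tilde a_k)+\dots+\tilde p^{k-1}\tilde a_k}.$$ The associated space is $L_T=\mathrm{span}_A\{T(p^1,\dots,p^{k-1},-)\mid p^i\in V^*\}\subset V$, where the $p^i$ may have arbitrary parity and a linear function of one covector is identified with a vector of $V$. $T$ is non-degenerate if at least one component $T^{a_1\dots a_k}$ with all indices $a_1,\dots,a_k$ even is invertible. Even vectors $\mathbf u_1,\dots,\mathbf u_k$ are independent if the $k\times (n|m)$ matrix of their coordinates contains an invertible $k\times k$ submatrix formed by $k$ of the $n$ even columns. *)

theory Defs
  imports Complex_Main "HOL-Algebra.QuotRing"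
begin

text \<open>The homogeneous part of parity \<open>p\<close> is \<open>A p\<close>. Parities are natural numbers, and only their
  residue modulo 2 matters. The algebra is nonzero by the class axiom \<open>0 \<noteq> 1\<close>.\<close>

locale supercommutative_algebra =
  fixes A :: "nat \<Rightarrow> 'a::real_algebra_1 set"
  assumes parity_mod_2: "A (p + 2) = A p"
    and subspace: "Real_Vector_Spaces.subspace (A p)"
    and even_Int_odd: "A 0 \<inter> A 1 = {0}"
    and even_plus_odd: "\<exists>y\<in>A 0. \<exists>z\<in>A 1. x = y + z"
    and one_even: "1 \<in> A 0"
    and mult_homogeneous: "\<lbrakk>x \<in> A p; y \<in> A q\<rbrakk> \<Longrightarrow> x * y \<in> A (p + q)"
    and supercommute: "\<lbrakk>x \<in> A p; y \<in> A q\<rbrakk> \<Longrightarrow> x * y = (-1) ^ (p * q) * (y * x)"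

definition even_component :: "(nat \<Rightarrow> 'a::real_algebra_1 set) \<Rightarrow> 'a \<Rightarrow> 'a" where
  "even_component A x = (THE y. y \<in> A 0 \<and> x - y \<in> A 1)"

text \<open>The sign picked up by a scalar that is moved past an element of parity \<open>p\<close>: a homogeneous
  scalar \<open>x\<close> of parity \<open>q\<close> is sent to \<open>(-1) ^ (p * q) * x\<close>.\<close>

definition twist :: "(nat \<Rightarrow> 'a::real_algebra_1 set) \<Rightarrow> nat \<Rightarrow> 'a \<Rightarrow> 'a" where
  "twist A p x = even_component A x + (-1) ^ p * (x - even_component A x)"

definition invertible_element :: "'a::monoid_mult \<Rightarrow> bool" where
  "invertible_element x \<longleftrightarrow> (\<exists>y. x * y = 1 \<and> y * x = 1)"

text \<open>The basis of \<open>V\<close> is indexed by a finite type, and \<open>Od\<close> is the set of odd indices, so that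
  \<open>V\<close> has rank \<open>card (- Od) | card Od\<close>. The vector \<open>v\<close> stands for the sum of the \<open>v a \<cdot> e\<^sub>a\<close>.
  Likewise \<open>t\<close> on words of indices stands for the sum of the
  \<open>t [a\<^sub>1,\<dots>,a\<^sub>k] \<cdot> e\<^bsub>a\<^sub>1\<^esub> \<otimes> \<dots> \<otimes> e\<^bsub>a\<^sub>k\<^esub>\<close>.\<close>

definition index_parity :: "'i set \<Rightarrow> 'i \<Rightarrow> nat" where
  "index_parity Od a = (if a \<in> Od then 1 else 0)"

definition word_parity :: "'i set \<Rightarrow> 'i list \<Rightarrow> nat" where
  "word_parity Od w = (\<Sum>a\<leftarrow>w. index_parity Od a)"

text \<open>Also used for covectors, given by their components \<open>p a = e\<^sub>a(p)\<close>.\<close>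

definition homogeneous ::
  "(nat \<Rightarrow> 'a::real_algebra_1 set) \<Rightarrow> 'i set \<Rightarrow> nat \<Rightarrow> ('i \<Rightarrow> 'a) \<Rightarrow> bool" where
  "homogeneous A Od q v \<longleftrightarrow> (\<forall>a. v a \<in> A (q + index_parity Od a))"

text \<open>Multiplication uses \<open>(x \<cdot> e\<^sub>w) \<otimes> (y \<cdot> e\<^sub>v) = (-1) ^ (parity y * parity w) x y \<cdot> e\<^bsub>wv\<^esub>\<close> for
  homogeneous \<open>y\<close>.\<close>

definition tensor_algebra ::
  "(nat \<Rightarrow> 'a::real_algebra_1 set) \<Rightarrow> 'i set \<Rightarrow> ('i list \<Rightarrow> 'a) ring" where
  "tensor_algebra A Od =
    \<lparr>carrier = {t. finite {w. t w \<noteq> 0}},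
     mult = (\<lambda>s t w. \<Sum>i\<le>length w.
       s (take i w) * twist A (word_parity Od (take i w)) (t (drop i w))),
     one = (\<lambda>w. if w = [] then 1 else 0),
     zero = (\<lambda>w. 0),
     add = (\<lambda>s t w. s w + t w)\<rparr>"

definition tensor_of_vector :: "('i \<Rightarrow> 'a::zero) \<Rightarrow> 'i list \<Rightarrow> 'a" where
  "tensor_of_vector v = (\<lambda>w. case w of [a] \<Rightarrow> v a | _ \<Rightarrow> 0)"

definition tensor_power :: "nat \<Rightarrow> ('i list \<Rightarrow> 'a::zero) set" where
  "tensor_power k = {t. \<forall>w. length w \<noteq> k \<longrightarrow> t w = 0}"

definition even_tensor ::
  "(nat \<Rightarrow> 'a::real_algebra_1 set) \<Rightarrow> 'i set \<Rightarrow> ('i list \<Rightarrow> 'a) \<Rightarrow> bool" where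
  "even_tensor A Od t \<longleftrightarrow> (\<forall>w. t w \<in> A (word_parity Od w))"

definition exterior_relations ::
  "(nat \<Rightarrow> 'a::real_algebra_1 set) \<Rightarrow> 'i set \<Rightarrow> ('i list \<Rightarrow> 'a) set" where
  "exterior_relations A Od =
    {(\<lambda>x. (tensor_of_vector v \<otimes>\<^bsub>tensor_algebra A Od\<^esub> tensor_of_vector w) x +
       (-1) ^ (p * q) * (tensor_of_vector w \<otimes>\<^bsub>tensor_algebra A Od\<^esub> tensor_of_vector v) x)
     | v w p q. homogeneous A Od p v \<and> homogeneous A Od q w}"

definition exterior_ideal ::
  "(nat \<Rightarrow> 'a::real_algebra_1 set) \<Rightarrow> 'i set \<Rightarrow> ('i list \<Rightarrow> 'a) set" where
  "exterior_ideal A Od = Idl\<^bsub>tensor_algebra A Od\<^esub> (exterior_relations A Od)"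

definition exterior_algebra ::
  "(nat \<Rightarrow> 'a::real_algebra_1 set) \<Rightarrow> 'i set \<Rightarrow> ('i list \<Rightarrow> 'a) set ring" where
  "exterior_algebra A Od = tensor_algebra A Od Quot exterior_ideal A Od"

definition tensor_class ::
  "(nat \<Rightarrow> 'a::real_algebra_1 set) \<Rightarrow> 'i set \<Rightarrow> ('i list \<Rightarrow> 'a) \<Rightarrow> ('i list \<Rightarrow> 'a) set" where
  "tensor_class A Od t = exterior_ideal A Od +>\<^bsub>tensor_algebra A Od\<^esub> t"

abbreviation vector_class ::
  "(nat \<Rightarrow> 'a::real_algebra_1 set) \<Rightarrow> 'i set \<Rightarrow> ('i \<Rightarrow> 'a) \<Rightarrow> ('i list \<Rightarrow> 'a) set" where
  "vector_class A Od v \<equiv> tensor_class A Od (tensor_of_vector v)"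

definition even_multivectors ::
  "(nat \<Rightarrow> 'a::real_algebra_1 set) \<Rightarrow> 'i set \<Rightarrow> nat \<Rightarrow> ('i list \<Rightarrow> 'a) set set" where
  "even_multivectors A Od k =
    {tensor_class A Od t | t. t \<in> tensor_power k \<and> even_tensor A Od t}"

text \<open>Exactly one tensor qualifies for an even \<open>T\<close> in the \<open>k\<close>-th exterior power, because the
  scalars contain the rationals: it is the skew-symmetrization of any degree-\<open>k\<close> representative of \<open>T\<close>.\<close>

definition components ::
  "(nat \<Rightarrow> 'a::real_algebra_1 set) \<Rightarrow> 'i set \<Rightarrow> nat \<Rightarrow> ('i list \<Rightarrow> 'a) set \<Rightarrow> 'i list \<Rightarrow> 'a" where
  "components A Od k T = (THE t. t \<in> tensor_power k \<and> even_tensor A Od t \<and>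
    (\<forall>xs a b ys. t (xs @ a # b # ys) =
      - ((-1) ^ (index_parity Od a * index_parity Od b)) * t (xs @ b # a # ys)) \<and>
    T = tensor_class A Od t)"

text \<open>The value of a tensor on the covectors \<open>p 0, \<dots>, p (k - 1)\<close> of parities
  \<open>q 0, \<dots>, q (k - 1)\<close>.\<close>

definition tensor_eval ::
  "'i set \<Rightarrow> nat \<Rightarrow> ('i list \<Rightarrow> 'a::real_algebra_1) \<Rightarrow> (nat \<Rightarrow> nat) \<Rightarrow> (nat \<Rightarrow> 'i \<Rightarrow> 'a) \<Rightarrow> 'a" where
  "tensor_eval Od k t q p =
    (\<Sum>w | length w = k. t w * (\<Prod>i\<leftarrow>[0..<k]. p i (w ! i)) *
      (-1) ^ (\<Sum>i<k. q i * word_parity Od (drop (Suc i) w)))"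

text \<open>The vectors \<open>T(p\<^sup>1,\<dots>,p\<^sup>k\<^sup>-\<^sup>1,-)\<close>, where a vector \<open>v\<close> is the linear function sending a
  covector \<open>l\<close> to the sum of the \<open>v a * l a\<close>. Testing on homogeneous \<open>l\<close> determines \<open>v\<close>, since
  the dual basis is homogeneous.\<close>

definition contractions ::
  "(nat \<Rightarrow> 'a::real_algebra_1 set) \<Rightarrow> 'i::finite set \<Rightarrow> nat \<Rightarrow> ('i list \<Rightarrow> 'a) set \<Rightarrow>
    ('i \<Rightarrow> 'a) set" where
  "contractions A Od k T = {v. \<exists>q p. (\<forall>i<k - 1. homogeneous A Od (q i) (p i)) \<and>
    (\<forall>r l. homogeneous A Od r l \<longrightarrow>
      (\<Sum>a\<in>UNIV. v a * l a) =
        tensor_eval Od k (components A Od k T) (q(k - 1 := r)) (p(k - 1 := l)))}"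

definition left_span :: "('i \<Rightarrow> 'a::ring_1) set \<Rightarrow> ('i \<Rightarrow> 'a) set" where
  "left_span S = {(\<lambda>a. \<Sum>v\<in>F. c v * v a) | c F. finite F \<and> F \<subseteq> S}"

definition associated_space ::
  "(nat \<Rightarrow> 'a::real_algebra_1 set) \<Rightarrow> 'i::finite set \<Rightarrow> nat \<Rightarrow> ('i list \<Rightarrow> 'a) set \<Rightarrow>
    ('i \<Rightarrow> 'a) set" where
  "associated_space A Od k T = left_span (contractions A Od k T)"

definition nondegenerate ::
  "(nat \<Rightarrow> 'a::real_algebra_1 set) \<Rightarrow> 'i set \<Rightarrow> nat \<Rightarrow> ('i list \<Rightarrow> 'a) set \<Rightarrow> bool" where
  "nondegenerate A Od k T \<longleftrightarrow>
    (\<exists>w. length w = k \<and> set w \<subseteq> - Od \<and> invertible_element (components A Od k T w))"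

definition invertible_matrix ::
  "'r set \<Rightarrow> 'c set \<Rightarrow> ('r \<Rightarrow> 'c \<Rightarrow> 'a::ring_1) \<Rightarrow> bool" where
  "invertible_matrix R C M \<longleftrightarrow> (\<exists>N.
    (\<forall>i\<in>R. \<forall>j\<in>R. (\<Sum>a\<in>C. M i a * N a j) = (if i = j then 1 else 0)) \<and>
    (\<forall>a\<in>C. \<forall>b\<in>C. (\<Sum>i\<in>R. N a i * M i b) = (if a = b then 1 else 0)))"

definition independent_vectors ::
  "'i set \<Rightarrow> nat \<Rightarrow> (nat \<Rightarrow> 'i \<Rightarrow> 'a::ring_1) \<Rightarrow> bool" where
  "independent_vectors Od k u \<longleftrightarrow>
    (\<exists>C. finite C \<and> C \<subseteq> - Od \<and> card C = k \<and> invertible_matrix {..<k} C u)"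

definition wedge_list ::
  "(nat \<Rightarrow> 'a::real_algebra_1 set) \<Rightarrow> 'i set \<Rightarrow> ('i \<Rightarrow> 'a) list \<Rightarrow> ('i list \<Rightarrow> 'a) set" where
  "wedge_list A Od us = foldr (\<lambda>u X. vector_class A Od u \<otimes>\<^bsub>exterior_algebra A Od\<^esub> X) us
    \<one>\<^bsub>exterior_algebra A Od\<^esub>"

definition simple_multivector ::
  "(nat \<Rightarrow> 'a::real_algebra_1 set) \<Rightarrow> 'i set \<Rightarrow> nat \<Rightarrow> ('i list \<Rightarrow> 'a) set \<Rightarrow> bool" where
  "simple_multivector A Od k T \<longleftrightarrow>
    (\<exists>u. (\<forall>i<k. homogeneous A Od 0 (u i)) \<and> independent_vectors Od k u \<and>
      T = wedge_list A Od (map u [0..<k]))"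

end

theory Submission
  imports Defs "HOL-Library.Multiset"
begin

text \<open>Write \<open>t\<close> for the skew tensor of the components of \<open>T\<close>. A tensor is congruent to its
  skew-symmetrization modulo the exterior ideal, and the only skew tensor in the ideal is \<open>0\<close>. Hence
  \<open>v \<and> T = 0\<close> can be tested on the explicit skew tensor \<open>wedge v t\<close>.

  If \<open>T = u\<^sub>1 \<and> \<dots> \<and> u\<^sub>k\<close> and \<open>p\<^sub>1, \<dots>, p\<^sub>k\<close> are even covectors dual to the \<open>u\<^sub>i\<close>, supported on
  the \<open>k\<close> columns \<open>C\<close> of an invertible submatrix, then contracting \<open>u\<^sub>1 \<and> \<dots> \<and> u\<^sub>k\<close> with all of them gives
  \<open>1\<close>. By skew-symmetry the result is also a multiple of the single component on \<open>C\<close>, which is therefore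
  invertible. No determinants are needed. Contractions of \<open>T\<close> are linear combinations of the \<open>u\<^sub>i\<close>, so their
  products with \<open>T\<close> vanish.

  Conversely, let \<open>\<theta> = t(c\<^sub>1\<dots>c\<^sub>k)\<close> be invertible. Contracting \<open>T\<close> with all basis covectors
  \<open>c\<^sub>j\<close>, \<open>j \<noteq> i\<close>, and rescaling gives even vectors \<open>u\<^sub>i\<close> of the associated space that are dual to the
  \<open>c\<^sub>j\<close>. Contracting \<open>u\<^sub>i \<and> T = 0\<close> with \<open>c\<^sub>i\<close> shows that \<open>T\<close> is \<open>u\<^sub>i\<close> wedge the contraction
  of \<open>T\<close> with \<open>c\<^sub>i\<close>; iterating, \<open>T\<close> is \<open>\<theta>\<close> times the product of the \<open>u\<^sub>i\<close>, up to a factor \<open>k!\<close>.\<close>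

section \<open>Scalars: parity, even components and the parity automorphism\<close>

lemma scaleR_of_nat_Suc:
  fixes z :: "'a::real_algebra_1"
  shows "(1 / real (Suc n)) *\<^sub>R (of_nat (Suc n) * z) = z"
proof -
  have "of_nat (Suc n) * z = real (Suc n) *\<^sub>R z"
    unfolding scaleR_conv_of_real of_real_of_nat_eq ..
  then show ?thesis by simp
qed

lemma minus_one_power_commute: "(x::'a::ring_1) * (-1) ^ n = (-1) ^ n * x"
  by (simp add: minus_one_power_iff)

context supercommutative_algebra
begin

lemma A_mod_2: "A p = A (p mod 2)"
proof (induction p rule: less_induct)
  case (less p)
  show ?case
  proof (cases "p < 2")
    case False
    then obtain r where r: "p = r + 2" by (metis add.commute le_Suc_ex not_less)
    then show ?thesis using less[of r] parity_mod_2[of r] by simp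
  qed simp
qed

lemma A_cong: "even p = even q \<Longrightarrow> A p = A q"
  by (metis A_mod_2 parity_cases)

lemma A_add: "x \<in> A p \<Longrightarrow> y \<in> A p \<Longrightarrow> x + y \<in> A p"
  using subspace Real_Vector_Spaces.subspace_add by blast

lemma A_zero [simp]: "0 \<in> A p"
  using subspace Real_Vector_Spaces.subspace_0 by blast

lemma A_scaleR: "x \<in> A p \<Longrightarrow> c *\<^sub>R x \<in> A p"
  using subspace Real_Vector_Spaces.subspace_scale by blast

lemma A_minus: "x \<in> A p \<Longrightarrow> - x \<in> A p"
  using subspace Real_Vector_Spaces.subspace_neg by blast

lemma A_diff: "x \<in> A p \<Longrightarrow> y \<in> A p \<Longrightarrow> x - y \<in> A p"
  using subspace Real_Vector_Spaces.subspace_diff by blast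

lemma A_sum: "(\<And>i. i \<in> S \<Longrightarrow> f i \<in> A p) \<Longrightarrow> sum f S \<in> A p"
  by (induction S rule: infinite_finite_induct) (auto simp: A_add)

lemma A_sign: "x \<in> A p \<Longrightarrow> (-1) ^ n * x \<in> A p"
  by (simp add: minus_one_power_iff A_minus)

lemma even_component_unique:
  assumes "y \<in> A 0" "x - y \<in> A 1"
  shows "even_component A x = y"
  unfolding even_component_def
proof (rule the_equality)
  fix z assume z: "z \<in> A 0 \<and> x - z \<in> A 1"
  have "y - z \<in> A 0" using z assms A_diff by blast
  moreover have "y - z \<in> A 1" using z assms A_diff[of "x - z" 1 "x - y"] by simp
  ultimately have "y - z \<in> A 0 \<inter> A 1" by blast
  then show "z = y" unfolding even_Int_odd by simp
qed (use assms in auto)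

lemma even_component_in: "even_component A x \<in> A 0" "x - even_component A x \<in> A 1"
proof -
  obtain y z where "y \<in> A 0" "z \<in> A 1" "x = y + z" using even_plus_odd by blast
  then have "even_component A x = y" using even_component_unique[of y x] by simp
  then show "even_component A x \<in> A 0" "x - even_component A x \<in> A 1"
    using \<open>y \<in> A 0\<close> \<open>z \<in> A 1\<close> \<open>x = y + z\<close> by auto
qed

lemma even_component_add: "even_component A (x + y) = even_component A x + even_component A y"
  by (rule even_component_unique)
    (use even_component_in A_add[of "x - even_component A x" 1 "y - even_component A y"]
      in \<open>auto intro: A_add simp: algebra_simps\<close>)

lemma even_component_even: "x \<in> A 0 \<Longrightarrow> even_component A x = x"
  by (rule even_component_unique) auto

lemma even_component_sum: "even_component A (\<Sum>i\<in>S. f i) = (\<Sum>i\<in>S. even_component A (f i))"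
  by (induction S rule: infinite_finite_induct) (auto simp: even_component_add even_component_even)

lemma even_component_mult_even:
  assumes "x \<in> A 0"
  shows "even_component A (x * y) = x * even_component A y"
  using even_component_in[of y] mult_homogeneous[OF assms]
  by (intro even_component_unique) (force simp: right_diff_distrib[symmetric])+

lemma twist_homogeneous:
  assumes "x \<in> A q"
  shows "twist A p x = (-1) ^ (p * q) * x"
proof (cases "even q")
  case True
  then have "x \<in> A 0" using assms A_cong[of q 0] by simp
  then show ?thesis using True by (simp add: twist_def even_component_even minus_one_power_iff)
next
  case False
  then have "x \<in> A 1" using assms A_cong[of q 1] by simp
  then have "even_component A x = 0" by (intro even_component_unique) auto
  then show ?thesis using False by (simp add: twist_def minus_one_power_iff)
qed

lemma twist_add: "twist A p (x + y) = twist A p x + twist A p y"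
  unfolding twist_def even_component_add by (simp add: algebra_simps)

text \<open>Reduces additive statements to homogeneous elements, on which \<open>twist\<close> is
  just a sign.\<close>

lemma homogeneous_induct:
  assumes "\<And>q x. x \<in> A q \<Longrightarrow> P x" "\<And>x y. P x \<Longrightarrow> P y \<Longrightarrow> P (x + y)"
  shows "P x"
  using even_plus_odd[of x] assms by blast

text \<open>\<open>twist A p\<close> is the p-th power of the parity automorphism: parities add
  under multiplication, so the signs multiply.\<close>

lemma twist_mult: "twist A p (x * y) = twist A p x * twist A p y"
proof (induction x rule: homogeneous_induct)
  case (1 q x)
  show ?case
  proof (induction y rule: homogeneous_induct)
    case (1 r y)
    then show ?case
      using \<open>x \<in> A q\<close> mult_homogeneous[of x q y r]
      by (simp add: twist_homogeneous distrib_left minus_one_power_iff)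
  next
    case (2 y z)
    then show ?case by (simp add: twist_add distrib_left)
  qed
next
  case (2 x z)
  then show ?case by (simp add: twist_add distrib_right)
qed

lemma twist_twist: "twist A p (twist A q x) = twist A (p + q) x"
proof (induction x rule: homogeneous_induct)
  case (1 r x)
  have "(-1) ^ (q * r) * x \<in> A r" using 1 by (rule A_sign)
  then show ?case
    using 1 by (simp add: twist_homogeneous distrib_right minus_one_power_iff)
next
  case (2 x y)
  then show ?case by (simp add: twist_add)
qed

lemma twist_scaleR: "twist A p (c *\<^sub>R x) = c *\<^sub>R twist A p x"
proof (induction x rule: homogeneous_induct)
  case (1 r x)
  then show ?case using A_scaleR[OF 1, of c] by (simp add: twist_homogeneous)
next
  case (2 x y)
  then show ?case by (simp add: twist_add scaleR_add_right)
qed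

lemma twist_0 [simp]: "twist A p 0 = 0"
  using twist_scaleR[of p 0 0] by simp

lemma twist_zero [simp]: "twist A 0 x = x"
  by (simp add: twist_def)

lemma twist_minus [simp]: "twist A p (- x) = - twist A p x"
  using twist_scaleR[of p "-1" x] by simp

lemma twist_sign: "twist A p ((-1) ^ n * x) = (-1) ^ n * twist A p x"
  by (simp add: minus_one_power_iff)

lemma twist_diff: "twist A p (x - y) = twist A p x - twist A p y"
  using twist_add[of p x "- y"] by simp

lemma twist_sum: "twist A p (sum f S) = (\<Sum>i\<in>S. twist A p (f i))"
  by (induction S rule: infinite_finite_induct) (auto simp: twist_add)

lemma twist_even: "x \<in> A 0 \<Longrightarrow> twist A p x = x"
  by (simp add: twist_homogeneous)

lemma twist_one [simp]: "twist A p 1 = 1"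
  by (simp add: twist_even one_even)

lemma even_central:
  assumes "x \<in> A 0"
  shows "x * y = y * x"
proof (induction y rule: homogeneous_induct)
  case (1 q y)
  then show ?case using supercommute[OF assms 1] by simp
next
  case (2 y z)
  then show ?case by (simp add: distrib_left distrib_right)
qed

text \<open>Multiplication by the even x commutes with taking even components, so the even component
  of y is also inverse to x. Since x is central, the two inverses agree.\<close>

lemma inverse_even:
  assumes "x \<in> A 0" "x * y = 1"
  shows "y \<in> A 0"
proof -
  have e: "x * even_component A y = 1"
    using assms even_component_mult_even[of x y] even_component_even[OF one_even] by simp
  have "y = (even_component A y * x) * y"
    using e even_central[OF assms(1), of "even_component A y"] by simp
  also have "\<dots> = even_component A y" by (simp add: mult.assoc assms(2))
  finally show ?thesis using even_component_in(1) by metis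
qed

lemma A_prod_list:
  "(\<And>x. x \<in> set xs \<Longrightarrow> f x \<in> A (g x)) \<Longrightarrow> (\<Prod>x\<leftarrow>xs. f x) \<in> A (\<Sum>x\<leftarrow>xs. g x)"
  by (induction xs) (auto simp: one_even mult_homogeneous)

end

section \<open>The free module: parities of indices and of words\<close>

locale super_module = supercommutative_algebra A
  for A :: "nat \<Rightarrow> 'a::real_algebra_1 set" +
  fixes Od :: "'i::finite set"
begin

abbreviation "ip \<equiv> index_parity Od"
abbreviation "wp \<equiv> word_parity Od"
abbreviation "TA \<equiv> tensor_algebra A Od"

lemma wp_simps [simp]: "wp [] = 0" "wp (a # w) = ip a + wp w" "wp (v @ w) = wp v + wp w"
  by (simp_all add: word_parity_def)

lemma ip_even: "a \<notin> Od \<Longrightarrow> ip a = 0"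
  by (simp add: index_parity_def)

lemma wp_even: "set w \<subseteq> - Od \<Longrightarrow> wp w = 0"
  by (induction w) (auto simp: ip_even)

lemma finite_words [simp]: "finite {w :: 'i list. length w = n}"
  using finite_lists_length_eq[of "UNIV :: 'i set" n] by simp

subsection \<open>The tensor algebra\<close>

lemma TA_simps:
  "carrier TA = {t. finite {w. t w \<noteq> 0}}"
  "\<zero>\<^bsub>TA\<^esub> = (\<lambda>w. 0)"
  "\<one>\<^bsub>TA\<^esub> = (\<lambda>w. if w = [] then 1 else 0)"
  "s \<oplus>\<^bsub>TA\<^esub> t = (\<lambda>w. s w + t w)"
  "s \<otimes>\<^bsub>TA\<^esub> t = (\<lambda>w. \<Sum>i\<le>length w. s (take i w) * twist A (wp (take i w)) (t (drop i w)))"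
  by (simp_all add: tensor_algebra_def)

lemma TA_mult_Nil: "(s \<otimes>\<^bsub>TA\<^esub> t) [] = s [] * t []"
  by (simp add: TA_simps)

text \<open>Peels off the first letter: either the left factor contributes nothing to it, or it
  belongs to the left factor and the right factor is twisted once. This lets products be compared by
  induction on words.\<close>

lemma TA_mult_Cons:
  "(s \<otimes>\<^bsub>TA\<^esub> t) (a # w) =
    s [] * t (a # w) + ((\<lambda>x. s (a # x)) \<otimes>\<^bsub>TA\<^esub> (\<lambda>x. twist A (ip a) (t x))) w"
  by (simp add: TA_simps sum.atMost_Suc_shift twist_twist add.commute del: sum.atMost_Suc)

lemma TA_carrier_mult:
  assumes "s \<in> carrier TA" "t \<in> carrier TA"
  shows "s \<otimes>\<^bsub>TA\<^esub> t \<in> carrier TA"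
proof -
  have "{w. (s \<otimes>\<^bsub>TA\<^esub> t) w \<noteq> 0} \<subseteq> (\<lambda>(x, y). x @ y) ` ({w. s w \<noteq> 0} \<times> {w. t w \<noteq> 0})"
  proof
    fix w assume "w \<in> {w. (s \<otimes>\<^bsub>TA\<^esub> t) w \<noteq> 0}"
    then obtain i where "s (take i w) * twist A (wp (take i w)) (t (drop i w)) \<noteq> 0"
      unfolding TA_simps by (metis (mono_tags, lifting) mem_Collect_eq sum.neutral)
    then have "s (take i w) \<noteq> 0" "t (drop i w) \<noteq> 0" by auto
    then show "w \<in> (\<lambda>(x, y). x @ y) ` ({w. s w \<noteq> 0} \<times> {w. t w \<noteq> 0})"
      by (auto intro!: image_eqI[where x = "(take i w, drop i w)"])
  qed
  then show ?thesis using assms unfolding TA_simps(1)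
    by (auto intro: finite_subset)
qed

lemma TA_twist_mult:
  "(\<lambda>x. twist A p ((s \<otimes>\<^bsub>TA\<^esub> t) x)) = (\<lambda>x. twist A p (s x)) \<otimes>\<^bsub>TA\<^esub> (\<lambda>x. twist A p (t x))"
  by (simp add: TA_simps twist_sum twist_mult twist_twist add.commute)

lemma TA_mult_add_left: "(\<lambda>w. r w + s w) \<otimes>\<^bsub>TA\<^esub> t = (\<lambda>w. (r \<otimes>\<^bsub>TA\<^esub> t) w + (s \<otimes>\<^bsub>TA\<^esub> t) w)"
  by (simp add: TA_simps distrib_right sum.distrib)

lemma TA_mult_add_right: "t \<otimes>\<^bsub>TA\<^esub> (\<lambda>w. r w + s w) = (\<lambda>w. (t \<otimes>\<^bsub>TA\<^esub> r) w + (t \<otimes>\<^bsub>TA\<^esub> s) w)"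
  by (simp add: TA_simps distrib_left sum.distrib twist_add)

lemma TA_mult_scale_left: "(\<lambda>w. r * s w) \<otimes>\<^bsub>TA\<^esub> t = (\<lambda>w. r * (s \<otimes>\<^bsub>TA\<^esub> t) w)"
  by (simp add: TA_simps sum_distrib_left mult.assoc)

text \<open>The induction on w must generalize over the tensors, because the recursion passes to
  shifted and twisted ones.\<close>

lemma TA_mult_assoc: "(r \<otimes>\<^bsub>TA\<^esub> s) \<otimes>\<^bsub>TA\<^esub> t = r \<otimes>\<^bsub>TA\<^esub> (s \<otimes>\<^bsub>TA\<^esub> t)"
proof
  fix w
  show "((r \<otimes>\<^bsub>TA\<^esub> s) \<otimes>\<^bsub>TA\<^esub> t) w = (r \<otimes>\<^bsub>TA\<^esub> (s \<otimes>\<^bsub>TA\<^esub> t)) w"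
  proof (induction w arbitrary: r s t)
    case Nil
    then show ?case by (simp add: TA_mult_Nil mult.assoc)
  next
    case (Cons a w)
    show ?case
      by (simp add: TA_mult_Cons TA_mult_Nil TA_mult_add_left TA_mult_scale_left Cons
          TA_twist_mult algebra_simps)
  qed
qed

lemma one_TA_mult: "\<one>\<^bsub>TA\<^esub> \<otimes>\<^bsub>TA\<^esub> t = t"
proof
  fix w
  have "(\<one>\<^bsub>TA\<^esub> \<otimes>\<^bsub>TA\<^esub> t) w = (\<Sum>i\<le>length w. if i = 0 then t w else 0)"
    unfolding TA_simps by (rule sum.cong) auto
  then show "(\<one>\<^bsub>TA\<^esub> \<otimes>\<^bsub>TA\<^esub> t) w = t w" by simp
qed

lemma TA_mult_one: "t \<otimes>\<^bsub>TA\<^esub> \<one>\<^bsub>TA\<^esub> = t"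
proof
  fix w
  have "(t \<otimes>\<^bsub>TA\<^esub> \<one>\<^bsub>TA\<^esub>) w = (\<Sum>i\<le>length w. if i = length w then t w else 0)"
    unfolding TA_simps by (rule sum.cong) auto
  then show "(t \<otimes>\<^bsub>TA\<^esub> \<one>\<^bsub>TA\<^esub>) w = t w" by simp
qed

lemma TA_carrier_add: "s \<in> carrier TA \<Longrightarrow> t \<in> carrier TA \<Longrightarrow> (\<lambda>w. s w + t w) \<in> carrier TA"
  unfolding TA_simps
  by (auto intro: finite_subset[where B = "{w. s w \<noteq> 0} \<union> {w. t w \<noteq> 0}"])

lemma TA_carrier_uminus: "t \<in> carrier TA \<Longrightarrow> (\<lambda>w. - t w) \<in> carrier TA"
  unfolding TA_simps by simp

lemma ring_TA: "ring TA"
proof (rule ringI)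
  show "abelian_group TA"
  proof (rule abelian_groupI)
    fix s assume "s \<in> carrier TA"
    then show "\<exists>t\<in>carrier TA. t \<oplus>\<^bsub>TA\<^esub> s = \<zero>\<^bsub>TA\<^esub>"
      by (intro bexI[of _ "\<lambda>w. - s w"]) (simp_all add: TA_simps)
  qed (use TA_carrier_add in \<open>auto simp: TA_simps add.assoc add.commute\<close>)
  show "monoid TA"
    by (rule monoidI)
      (use TA_carrier_mult TA_mult_assoc one_TA_mult TA_mult_one in \<open>auto simp: TA_simps(1,3)\<close>)
qed (simp_all only: TA_simps(4) TA_mult_add_left TA_mult_add_right)

sublocale TA: ring TA
  by (rule ring_TA)

lemma TA_uminus:
  assumes "t \<in> carrier TA"
  shows "\<ominus>\<^bsub>TA\<^esub> t = (\<lambda>w. - t w)"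
  using assms TA_carrier_uminus[OF assms]
  by (intro TA.minus_equality) (simp_all add: TA_simps)

lemma TA_minus:
  assumes "s \<in> carrier TA" "t \<in> carrier TA"
  shows "s \<ominus>\<^bsub>TA\<^esub> t = (\<lambda>w. s w - t w)"
  using assms by (simp add: a_minus_def TA_uminus TA_simps(4))

lemma tensor_power_carrier: "t \<in> tensor_power k \<Longrightarrow> t \<in> carrier TA"
  unfolding tensor_power_def TA_simps
  by (auto intro: finite_subset[OF _ finite_words[of k]])

lemma tensor_of_vector_power: "tensor_of_vector v \<in> tensor_power 1"
  by (auto simp: tensor_power_def tensor_of_vector_def split: list.split)

lemma tensor_of_vector_carrier [simp]: "tensor_of_vector v \<in> carrier TA"
  by (rule tensor_power_carrier[OF tensor_of_vector_power])

lemma tensor_of_vector_mult_Nil [simp]: "(tensor_of_vector v \<otimes>\<^bsub>TA\<^esub> t) [] = 0"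
  by (simp add: TA_mult_Nil tensor_of_vector_def)

lemma tensor_of_vector_mult_Cons [simp]:
  "(tensor_of_vector v \<otimes>\<^bsub>TA\<^esub> t) (a # w) = v a * twist A (ip a) (t w)"
proof -
  have "(\<lambda>x. tensor_of_vector v (a # x)) = (\<lambda>x. v a * \<one>\<^bsub>TA\<^esub> x)"
    by (auto simp: tensor_of_vector_def TA_simps split: list.split)
  then show ?thesis
    by (simp add: TA_mult_Cons TA_mult_scale_left one_TA_mult)
      (simp add: tensor_of_vector_def)
qed

lemma sum_words_Suc:
  fixes g :: "'i list \<Rightarrow> 'b::comm_monoid_add"
  shows "(\<Sum>w | length w = Suc n. g w) = (\<Sum>a\<in>UNIV. \<Sum>w | length w = n. g (a # w))"
  unfolding sum.cartesian_product
  by (rule sum.reindex_bij_witness[of _ "\<lambda>(a, w). a # w" "\<lambda>w. (hd w, tl w)"])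
    (auto simp: length_Suc_conv)

lemma sum_words_snoc:
  fixes g :: "'i list \<Rightarrow> 'b::comm_monoid_add"
  shows "(\<Sum>w | length w = Suc n. g w) = (\<Sum>a\<in>UNIV. \<Sum>w | length w = n. g (w @ [a]))"
  unfolding sum.cartesian_product
  by (rule sum.reindex_bij_witness[of _ "\<lambda>(a, w). w @ [a]" "\<lambda>w. (last w, butlast w)"])
    (auto simp: length_Suc_conv_rev)

text \<open>Used to pair a tensor product with a test function, summing over prefix and suffix
  independently.\<close>

lemma sum_words_split:
  fixes g :: "'i list \<Rightarrow> 'i list \<Rightarrow> 'b::comm_monoid_add"
  assumes "i \<le> n"
  shows "(\<Sum>w | length w = n. g (take i w) (drop i w)) =
    (\<Sum>x | length x = i. \<Sum>y | length y = n - i. g x y)"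
  unfolding sum.cartesian_product using assms
  by (intro sum.reindex_bij_witness[of _ "\<lambda>(x, y). x @ y" "\<lambda>w. (take i w, drop i w)"]) auto

subsection \<open>Skew-symmetric tensors and the exterior ideal\<close>

text \<open>The value ring is left open so that the same notion covers tensors over A and
  real-valued test functions.\<close>

definition skew :: "('i list \<Rightarrow> 'b::ring_1) \<Rightarrow> bool" where
  "skew f \<longleftrightarrow> (\<forall>xs a b ys. f (xs @ a # b # ys) = - ((-1) ^ (ip a * ip b)) * f (xs @ b # a # ys))"

lemma skewD: "skew f \<Longrightarrow> f (xs @ a # b # ys) = - ((-1) ^ (ip a * ip b)) * f (xs @ b # a # ys)"
  unfolding skew_def by blast

lemma skewI: "(\<And>xs a b ys. f (xs @ a # b # ys) = - ((-1) ^ (ip a * ip b)) * f (xs @ b # a # ys)) \<Longrightarrow> skew f"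
  unfolding skew_def by blast

lemma skew_append_left: "skew f \<Longrightarrow> skew (\<lambda>w. f (v @ w))"
  by (rule skewI) (use skewD[of f "v @ xs" for xs] in \<open>metis append_assoc\<close>)

lemma skew_append_right: "skew f \<Longrightarrow> skew (\<lambda>w. f (w @ v))"
  by (rule skewI) (use skewD[of f _ _ _ "ys @ v" for ys] in \<open>metis append_assoc append_Cons\<close>)

lemma skew_Cons: "skew f \<Longrightarrow> skew (\<lambda>w. f (a # w))"
  using skew_append_left[of f "[a]"] by simp

text \<open>Swapping two letters does not change the total parity of a word. The sign arises when an
  odd scalar on the right is moved past a word.\<close>

lemma skew_sign:
  assumes "skew f"
  shows "skew (\<lambda>w. (-1) ^ wp w * f w)"
proof (rule skewI)
  fix xs a b ys
  show "(-1) ^ wp (xs @ a # b # ys) * f (xs @ a # b # ys) =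
    - ((-1) ^ (ip a * ip b)) * ((-1) ^ wp (xs @ b # a # ys) * f (xs @ b # a # ys))"
    using skewD[OF assms, of xs a b ys] by (simp add: minus_one_power_iff)
qed

definition I where "I = exterior_ideal A Od"

lemma exterior_relations_carrier: "exterior_relations A Od \<subseteq> carrier TA"
proof -
  have "(\<lambda>x. p x + (-1) ^ n * q x) \<in> carrier TA" if "p \<in> carrier TA" "q \<in> carrier TA" for p q n
    using TA_carrier_add[of p "\<lambda>x. (-1) ^ n * q x"] that TA_carrier_uminus[of q]
    by (simp add: minus_one_power_iff)
  then show ?thesis unfolding exterior_relations_def
    by (auto intro!: TA_carrier_mult)
qed

lemma ideal_I: "ideal I TA"
  unfolding I_def exterior_ideal_def by (rule TA.genideal_ideal[OF exterior_relations_carrier])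

lemmas I_l_closed = ideal.I_l_closed[OF ideal_I]
  and I_r_closed = ideal.I_r_closed[OF ideal_I]

text \<open>Testing against real-valued functionals avoids all permutation signs: a skew tensor \<open>t\<close> in the
  annihilator is orthogonal to \<open>g \<circ> t\<close> for each real functional \<open>g\<close> on the scalars, so applying
  \<open>g\<close> once more makes a sum of squares vanish.\<close>

definition annihilator where "annihilator = {t \<in> carrier TA. \<forall>n (f :: 'i list \<Rightarrow> real). skew f \<longrightarrow>
  (\<Sum>w | length w = n. f w *\<^sub>R t w) = 0}"

text \<open>For a fixed prefix x the function \<open>f (x @ y)\<close> of y is again skew, so the
  inner sum over y vanishes; \<open>twist\<close> is real linear and can be taken outside that
  sum.\<close>

lemma annihilator_mult_left:
  assumes t: "t \<in> annihilator" and s: "s \<in> carrier TA"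
  shows "s \<otimes>\<^bsub>TA\<^esub> t \<in> annihilator"
  unfolding annihilator_def
proof (intro CollectI conjI allI impI)
  show "s \<otimes>\<^bsub>TA\<^esub> t \<in> carrier TA" using assms TA_carrier_mult by (auto simp: annihilator_def)
  fix n and f :: "'i list \<Rightarrow> real" assume f: "skew f"
  have "(\<Sum>w | length w = n. f w *\<^sub>R (s \<otimes>\<^bsub>TA\<^esub> t) w) =
    (\<Sum>w | length w = n. \<Sum>i\<le>n. f (take i w @ drop i w) *\<^sub>R
      (s (take i w) * twist A (wp (take i w)) (t (drop i w))))"
    by (rule sum.cong) (auto simp: TA_simps scaleR_sum_right)
  also have "\<dots> = (\<Sum>i\<le>n. \<Sum>x | length x = i. \<Sum>y | length y = n - i.
      f (x @ y) *\<^sub>R (s x * twist A (wp x) (t y)))"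
    by (subst sum.swap, rule sum.cong[OF refl],
      subst sum_words_split[symmetric, of _ n "\<lambda>x y. f (x @ y) *\<^sub>R (s x * twist A (wp x) (t y))"]) auto
  also have "\<dots> = (\<Sum>i\<le>n. \<Sum>x | length x = i.
      s x * twist A (wp x) (\<Sum>y | length y = n - i. f (x @ y) *\<^sub>R t y))"
    by (simp add: twist_sum twist_scaleR sum_distrib_left)
  also have "\<dots> = 0"
    using t skew_append_left[OF f] by (auto simp: annihilator_def intro!: sum.neutral)
  finally show "(\<Sum>w | length w = n. f w *\<^sub>R (s \<otimes>\<^bsub>TA\<^esub> t) w) = 0" .
qed

lemma annihilator_mult_right:
  assumes t: "t \<in> annihilator" and s: "s \<in> carrier TA"
  shows "t \<otimes>\<^bsub>TA\<^esub> s \<in> annihilator"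
  unfolding annihilator_def
proof (intro CollectI conjI allI impI)
  show "t \<otimes>\<^bsub>TA\<^esub> s \<in> carrier TA" using assms TA_carrier_mult by (auto simp: annihilator_def)
  fix n and f :: "'i list \<Rightarrow> real" assume f: "skew f"
  \<comment> \<open>For z homogeneous of parity q, twisting gives the sign
    \<open>(-1) ^ (q * wp x)\<close>. It can be absorbed into the test function, which stays skew by
    \<open>skew_sign\<close>.\<close>
  have tw: "(\<Sum>x | length x = i. f (x @ y) *\<^sub>R (t x * twist A (wp x) z)) = 0" for i y z
  proof (induction z rule: homogeneous_induct)
    case (1 q z)
    have "(\<Sum>x | length x = i. ((-1) ^ (q * wp x) * f (x @ y)) *\<^sub>R t x) = 0"
      using t skew_append_right[OF f, of y] skew_sign[OF skew_append_right[OF f, of y]]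
      by (cases "even q") (auto simp: annihilator_def power_mult)
    then have "(\<Sum>x | length x = i. ((-1) ^ (q * wp x) * f (x @ y)) *\<^sub>R t x) * z = 0"
      by simp
    moreover have "((-1) ^ (q * wp x) * f (x @ y)) *\<^sub>R t x * z = f (x @ y) *\<^sub>R (t x * twist A (wp x) z)" for x
      using 1 by (simp add: twist_homogeneous minus_one_power_iff)
    ultimately show ?case by (simp add: sum_distrib_right)
  next
    case (2 y z)
    then show ?case by (simp add: twist_add distrib_left scaleR_add_right sum.distrib)
  qed
  have "(\<Sum>w | length w = n. f w *\<^sub>R (t \<otimes>\<^bsub>TA\<^esub> s) w) =
    (\<Sum>w | length w = n. \<Sum>i\<le>n. f (take i w @ drop i w) *\<^sub>R
      (t (take i w) * twist A (wp (take i w)) (s (drop i w))))"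
    by (rule sum.cong) (auto simp: TA_simps scaleR_sum_right)
  also have "\<dots> = (\<Sum>i\<le>n. \<Sum>x | length x = i. \<Sum>y | length y = n - i.
      f (x @ y) *\<^sub>R (t x * twist A (wp x) (s y)))"
    by (subst sum.swap, rule sum.cong[OF refl],
      subst sum_words_split[symmetric, of _ n "\<lambda>x y. f (x @ y) *\<^sub>R (t x * twist A (wp x) (s y))"]) auto
  also have "\<dots> = 0"
    by (rule sum.neutral, rule ballI, subst sum.swap, simp add: tw)
  finally show "(\<Sum>w | length w = n. f w *\<^sub>R (t \<otimes>\<^bsub>TA\<^esub> s) w) = 0" .
qed

lemma tensor_of_vector_mult:
  "(tensor_of_vector v \<otimes>\<^bsub>TA\<^esub> tensor_of_vector w) x =
    (case x of [a, b] \<Rightarrow> v a * twist A (ip a) (w b) | _ \<Rightarrow> 0)"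
proof (cases x)
  case (Cons a y)
  then show ?thesis by (simp, auto simp: tensor_of_vector_def split: list.split)
qed simp

text \<open>Only words of length 2 matter. After exchanging the two summation indices in the second
  product, the signs from skewness of f, from supercommutativity and from the twists combine to turn
  each term into the negative of one in the first product.\<close>

lemma exterior_relations_annihilator: "exterior_relations A Od \<subseteq> annihilator"
proof
  fix t assume t: "t \<in> exterior_relations A Od"
  then obtain v w p q where hom: "homogeneous A Od p v" "homogeneous A Od q w"
    and t_eq: "t = (\<lambda>x. (tensor_of_vector v \<otimes>\<^bsub>TA\<^esub> tensor_of_vector w) x +
       (-1) ^ (p * q) * (tensor_of_vector w \<otimes>\<^bsub>TA\<^esub> tensor_of_vector v) x)"
    unfolding exterior_relations_def by blast
  have "(\<Sum>x | length x = n. f x *\<^sub>R t x) = 0" if f: "skew f" for n and f :: "'i list \<Rightarrow> real"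
  proof (cases "n = 2")
    case False
    then show ?thesis
      by (intro sum.neutral) (auto simp: t_eq tensor_of_vector_mult split: list.split)
  next
    case True
    have *: "f [b, a] *\<^sub>R ((-1) ^ (p * q) * (w b * twist A (ip b) (v a))) =
      - f [a, b] *\<^sub>R (v a * twist A (ip a) (w b))" for a b
    proof -
      have v: "v a \<in> A (p + ip a)" and w: "w b \<in> A (q + ip b)"
        using hom by (auto simp: homogeneous_def)
      have "w b * v a = (-1) ^ ((q + ip b) * (p + ip a)) * (v a * w b)"
        using supercommute[OF w v] .
      then show ?thesis
        using skewD[OF f, of "[]" b a "[]"]
        by (simp add: twist_homogeneous[OF v] twist_homogeneous[OF w] minus_one_power_iff
            index_parity_def)
    qed
    have "(\<Sum>x | length x = n. f x *\<^sub>R t x) =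
      (\<Sum>a\<in>UNIV. \<Sum>b\<in>UNIV. f [a, b] *\<^sub>R (v a * twist A (ip a) (w b))) +
      (\<Sum>a\<in>UNIV. \<Sum>b\<in>UNIV. f [a, b] *\<^sub>R ((-1) ^ (p * q) * (w a * twist A (ip a) (v b))))"
      by (simp add: True numeral_2_eq_2 sum_words_Suc t_eq tensor_of_vector_mult
          scaleR_add_right sum.distrib)
    also have "(\<Sum>a\<in>UNIV. \<Sum>b\<in>UNIV. f [a, b] *\<^sub>R ((-1) ^ (p * q) * (w a * twist A (ip a) (v b)))) =
      (\<Sum>a\<in>UNIV. \<Sum>b\<in>UNIV. f [b, a] *\<^sub>R ((-1) ^ (p * q) * (w b * twist A (ip b) (v a))))"
      by (rule sum.swap)
    finally show ?thesis by (simp add: * sum_negf)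
  qed
  then show "t \<in> annihilator" using t exterior_relations_carrier by (auto simp: annihilator_def)
qed

lemma ideal_annihilator: "ideal annihilator TA"
proof (rule idealI[OF ring_TA])
  show "subgroup annihilator (add_monoid TA)"
  proof (rule TA.add.subgroupI)
    show "annihilator \<subseteq> carrier TA" by (auto simp: annihilator_def)
    show "annihilator \<noteq> {}" by (rule ex_in_conv[THEN iffD1], rule exI[of _ "\<lambda>w. 0"]) (simp add: annihilator_def TA_simps)
    fix s t assume st: "s \<in> annihilator" "t \<in> annihilator"
    then show "s \<oplus>\<^bsub>TA\<^esub> t \<in> annihilator"
      using TA_carrier_add[of s t]
      by (simp add: annihilator_def scaleR_add_right sum.distrib TA_simps(4))
    have "s \<in> carrier TA" using st by (simp add: annihilator_def)
    then show "\<ominus>\<^bsub>TA\<^esub> s \<in> annihilator"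
      using TA_carrier_uminus[of s] st by (simp add: annihilator_def TA_uminus sum_negf)
  qed
qed (auto intro: annihilator_mult_left annihilator_mult_right)

lemma I_subset_annihilator: "I \<subseteq> annihilator"
  unfolding I_def exterior_ideal_def
  by (rule TA.genideal_minimal[OF ideal_annihilator exterior_relations_annihilator])

text \<open>A nonzero x is linearly independent, so the value 1 at x extends to a linear
  functional.\<close>

lemma real_functional_separates:
  fixes x :: "'b::real_vector"
  assumes "x \<noteq> 0"
  shows "\<exists>g :: 'b \<Rightarrow> real. linear g \<and> g x \<noteq> 0"
proof -
  have "independent {x}" using assms by simp
  from real_vector.linear_independent_extend[OF this, of "\<lambda>_. 1"]
  obtain g :: "'b \<Rightarrow> real" where "linear g" "g x = 1" by auto
  then show ?thesis by (intro exI[of _ g]) simp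
qed

lemma skew_I_eq_0:
  assumes "skew t" "t \<in> I"
  shows "t w = 0"
proof (rule ccontr)
  assume "t w \<noteq> 0"
  from real_functional_separates[OF this] obtain g :: "'a \<Rightarrow> real"
    where g: "linear g" "g (t w) \<noteq> 0" by blast
  have "skew (\<lambda>x. g (t x))"
  proof (rule skewI)
    fix xs a b ys
    show "g (t (xs @ a # b # ys)) = - ((-1) ^ (ip a * ip b)) * g (t (xs @ b # a # ys))"
      using skewD[OF assms(1), of xs a b ys] linear_neg[OF g(1), of "t (xs @ b # a # ys)"]
      by (cases "even (ip a * ip b)") (simp_all add: minus_one_power_iff)
  qed
  then have "(\<Sum>x | length x = length w. g (t x) *\<^sub>R t x) = 0"
    using assms I_subset_annihilator by (auto simp: annihilator_def)
  then have "g (\<Sum>x | length x = length w. g (t x) *\<^sub>R t x) = 0"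
    using g(1) by (simp add: linear_0)
  then have "(\<Sum>x | length x = length w. g (t x) * g (t x)) = 0"
    using g(1) by (simp add: linear_sum linear_scale)
  moreover have "(\<Sum>x | length x = length w. g (t x) * g (t x)) > 0"
    by (rule sum_pos2[of _ w]) (use g in \<open>auto simp: zero_less_mult_iff linorder_neq_iff\<close>)
  ultimately show False by simp
qed

lemma I_zero [simp]: "(\<lambda>w. 0) \<in> I"
  using additive_subgroup.zero_closed[OF ideal.axioms(1)[OF ideal_I]] by (simp add: TA_simps)

lemma I_add: "s \<in> I \<Longrightarrow> t \<in> I \<Longrightarrow> (\<lambda>w. s w + t w) \<in> I"
  using additive_subgroup.a_closed[OF ideal.axioms(1)[OF ideal_I]] by (simp add: TA_simps)

lemma I_sum: "(\<And>j. j \<in> F \<Longrightarrow> h j \<in> I) \<Longrightarrow> (\<lambda>w. \<Sum>j\<in>F. h j w) \<in> I"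
  by (induction F rule: infinite_finite_induct) (auto simp: I_add)

section \<open>Basis tensors and the exchange of adjacent letters modulo the exterior ideal\<close>

definition mon :: "'i list \<Rightarrow> 'i list \<Rightarrow> 'a" where
  "mon x = (\<lambda>w. if w = x then 1 else 0)"

lemma mon_carrier [simp]: "mon x \<in> carrier TA"
  by (simp add: mon_def TA_simps(1))

lemma one_TA_mon: "\<one>\<^bsub>TA\<^esub> = mon []"
  by (simp add: mon_def TA_simps(3))

lemma twist_mon [simp]: "twist A p (mon x w) = mon x w"
  by (simp add: mon_def)

lemma mon_mult:
  "(mon x \<otimes>\<^bsub>TA\<^esub> t) w = (if take (length x) w = x then twist A (wp x) (t (drop (length x) w)) else 0)"
proof -
  have "(mon x \<otimes>\<^bsub>TA\<^esub> t) w = (\<Sum>i\<le>length w. if i = length x then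
      (if take (length x) w = x then twist A (wp x) (t (drop (length x) w)) else 0) else 0)"
    unfolding TA_simps by (rule sum.cong) (auto simp: mon_def)
  then show ?thesis by (auto simp: not_le)
qed

lemma mult_mon:
  "(t \<otimes>\<^bsub>TA\<^esub> mon y) w = (if length y \<le> length w \<and> drop (length w - length y) w = y
    then t (take (length w - length y) w) else 0)"
proof -
  have "(t \<otimes>\<^bsub>TA\<^esub> mon y) w = (\<Sum>i\<le>length w. if i = length w - length y then
      (if length y \<le> length w \<and> drop (length w - length y) w = y
    then t (take (length w - length y) w) else 0) else 0)"
    unfolding TA_simps by (rule sum.cong) (auto simp: mon_def)
  then show ?thesis by simp
qed

text \<open>Scaling by r is left multiplication by the degree-0 tensor with coefficient r.\<close>

lemma I_scale:
  assumes "t \<in> I"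
  shows "(\<lambda>w. r * t w) \<in> I"
proof -
  have "(\<lambda>w. r * mon [] w) \<in> carrier TA"
    unfolding TA_simps by (auto simp: mon_def intro: finite_subset[of _ "{[]}"])
  from I_l_closed[OF assms this] show ?thesis
    unfolding TA_mult_scale_left by (simp add: mon_mult)
qed

lemma tensor_of_basis_vector:
  "tensor_of_vector (\<lambda>c. if c = a then 1 else 0) = mon [a]"
  by (auto simp: tensor_of_vector_def mon_def split: list.split)

lemma homogeneous_basis_vector: "homogeneous A Od (ip a) (\<lambda>c. if c = a then 1 else 0)"
  using one_even A_cong[of "ip a + ip a" 0] by (simp add: homogeneous_def)

text \<open>The exterior relation for two basis vectors is multiplied by the basis tensors of x on
  the left and y on the right.\<close>

lemma swap_relation_I:
  "(\<lambda>w. mon (x @ a # b # y) w + (-1) ^ (ip a * ip b) * mon (x @ b # a # y) w) \<in> I"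
proof -
  let ?R = "\<lambda>w. mon [a, b] w + (-1) ^ (ip a * ip b) * mon [b, a] w"
  have mm: "mon [c] \<otimes>\<^bsub>TA\<^esub> mon [d] = mon [c, d]" for c d
  proof
    show "(mon [c] \<otimes>\<^bsub>TA\<^esub> mon [d]) w = mon [c, d] w" for w
      by (cases w) (simp_all add: mon_mult, simp_all add: mon_def)
  qed
  have "?R \<in> exterior_relations A Od"
    using homogeneous_basis_vector[of a] homogeneous_basis_vector[of b]
    unfolding exterior_relations_def mm[symmetric] tensor_of_basis_vector[symmetric] by blast
  then have R: "?R \<in> I"
    unfolding I_def exterior_ideal_def using TA.genideal_self[OF exterior_relations_carrier] by blast
  have "mon x \<otimes>\<^bsub>TA\<^esub> (?R \<otimes>\<^bsub>TA\<^esub> mon y) \<in> I"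
    by (intro I_l_closed I_r_closed R mon_carrier)
  moreover have "mon x \<otimes>\<^bsub>TA\<^esub> (?R \<otimes>\<^bsub>TA\<^esub> mon y) =
    (\<lambda>w. mon (x @ a # b # y) w + (-1) ^ (ip a * ip b) * mon (x @ b # a # y) w)"
  proof
    fix w
    show "(mon x \<otimes>\<^bsub>TA\<^esub> (?R \<otimes>\<^bsub>TA\<^esub> mon y)) w =
      mon (x @ a # b # y) w + (-1) ^ (ip a * ip b) * mon (x @ b # a # y) w"
    \<comment> \<open>Both sides vanish unless w has prefix x and the rest has suffix y; what
      remains in between is then compared with the two-letter words.\<close>
    proof (cases "\<exists>z. w = x @ z")
      case False
      then have "take (length x) w \<noteq> x" by (metis append_take_drop_id)
      moreover have "mon (x @ v) w = 0" for v using False by (simp add: mon_def)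
      ultimately show ?thesis by (simp add: mon_mult)
    next
      case True
      then obtain z where z: "w = x @ z" by blast
      show ?thesis
      proof (cases "\<exists>r. z = r @ y")
        case False
        have "mon (x @ c # d # y) w = 0" for c d
          using False[unfolded not_ex, THEN spec[of _ "[c, d]"]] by (simp add: mon_def z)
        moreover have "drop (length z - length y) z \<noteq> y"
          using False by (metis append_take_drop_id)
        ultimately show ?thesis by (simp add: z mon_mult mult_mon)
      next
        case True
        then obtain r where "z = r @ y" by blast
        then have w: "w = x @ r @ y" using z by simp
        have "mon (x @ c # d # y) w = mon [c, d] r" for c d
          using append_same_eq[of r y "[c, d]"] by (simp add: mon_def w)
        then show ?thesis
          by (simp add: w mon_mult mult_mon twist_add twist_sign)
      qed
    qed
  qed
  ultimately show ?thesis by simp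
qed

text \<open>\<open>f - g\<close> is the sum over all words of \<open>f w\<close> times the exterior relation for the letters
  \<open>i\<close> and \<open>i + 1\<close> of \<open>w\<close>.\<close>

lemma swap_congruent:
  assumes f: "f \<in> tensor_power n" and g: "g \<in> tensor_power n"
    and swap: "\<And>x a b y. length x = i \<Longrightarrow>
      g (x @ b # a # y) = - ((-1) ^ (ip a * ip b)) * f (x @ a # b # y)"
    and i: "Suc i < n"
  shows "(\<lambda>w. f w - g w) \<in> I"
proof -
  define sw :: "'i list \<Rightarrow> 'i list" where "sw w = take i w @ w ! Suc i # w ! i # drop (Suc (Suc i)) w" for w
  define sg :: "'i list \<Rightarrow> nat" where "sg w = ip (w ! i) * ip (w ! Suc i)" for w
  have split: "\<exists>x a b y. w = x @ a # b # y \<and> length x = i" if "length w = n" for w :: "'i list"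
    using i that id_take_nth_drop[of i w] id_take_nth_drop[of "Suc i" w]
    by (intro exI[of _ "take i w"] exI[of _ "w ! i"] exI[of _ "w ! Suc i"] exI[of _ "drop (Suc (Suc i)) w"])
      (simp add: Cons_nth_drop_Suc)
  have sw: "sw (x @ a # b # y) = x @ b # a # y" "sg (x @ a # b # y) = ip a * ip b"
    if "length x = i" for x a b y
    using that by (simp_all add: sw_def sg_def nth_append)
  have sw_sw: "sw (sw w) = w" "length (sw w) = n" "sg (sw w) = sg w"
    "g (sw w) = - ((-1) ^ sg w) * f w" if "length w = n" for w
    using split[OF that] that by (auto simp: sw swap mult.commute)
  have "(\<lambda>v. \<Sum>w | length w = n. f w * (mon w v + (-1) ^ sg w * mon (sw w) v)) \<in> I"
  proof (intro I_sum I_scale)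
    fix w :: "'i list" assume "w \<in> {w. length w = n}"
    then obtain x a b y where "w = x @ a # b # y" "length x = i" using split by blast
    then show "(\<lambda>v. mon w v + (-1) ^ sg w * mon (sw w) v) \<in> I"
      using swap_relation_I[of x a b y] by (simp add: sw)
  qed
  moreover have "(\<Sum>w | length w = n. f w * (mon w v + (-1) ^ sg w * mon (sw w) v)) = f v - g v" for v
  proof (cases "length v = n")
    case False
    then show ?thesis
      using f g sw_sw(2) by (intro trans[OF sum.neutral]) (auto simp: tensor_power_def mon_def)
  next
    case True
    \<comment> \<open>Since \<open>sw\<close> is an involution, only w = v and w =
      \<open>sw v\<close> contribute at v. They are kept as separate summands because
      \<open>sw v\<close> equals v when the exchanged letters agree.\<close>
    have "f w * (mon w v + (-1) ^ sg w * mon (sw w) v) =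
      (if w = v then f v else 0) + (if w = sw v then f (sw v) * (-1) ^ sg v else 0)"
      if "length w = n" for w
    proof -
      have "v = sw w \<longleftrightarrow> w = sw v" using sw_sw(1)[OF that] sw_sw(1)[OF True] by metis
      then show ?thesis using sw_sw(3)[OF True] by (simp add: mon_def distrib_left)
    qed
    then have "(\<Sum>w | length w = n. f w * (mon w v + (-1) ^ sg w * mon (sw w) v)) =
      (\<Sum>w | length w = n. (if w = v then f v else 0)) +
      (\<Sum>w | length w = n. (if w = sw v then f (sw v) * (-1) ^ sg v else 0))"
      unfolding sum.distrib[symmetric]
      by (intro sum.cong refl) simp
    also have "\<dots> = f v + (-1) ^ sg v * f (sw v)"
      using True sw_sw(2)[OF True] by (simp add: minus_one_power_commute)
    \<comment> \<open>This is the exchange hypothesis read at \<open>sw v\<close>, using that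
      \<open>sw\<close> undoes itself.\<close>
    also have "\<dots> = f v - g v"
      using sw_sw(4)[of "sw v"] sw_sw(1-3)[OF True] by simp
    finally show ?thesis .
  qed
  ultimately show ?thesis by (simp only:)
qed

lemma skew_scale:
  assumes "skew t"
  shows "skew (\<lambda>w. r * t w)"
proof (rule skewI)
  show "r * t (xs @ a # b # ys) = - ((-1) ^ (ip a * ip b)) * (r * t (xs @ b # a # ys))" for xs a b ys
    using skewD[OF assms, of xs a b ys] by (simp add: minus_one_power_iff)
qed

lemma skew_scaleR:
  fixes t :: "'i list \<Rightarrow> 'a"
  shows "skew t \<Longrightarrow> skew (\<lambda>w. c *\<^sub>R t w)"
  using skew_scale[of t "of_real c"] by (simp add: scaleR_conv_of_real)

lemma skew_add:
  assumes "skew s" "skew t"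
  shows "skew (\<lambda>w. s w + t w)"
proof (rule skewI)
  show "s (xs @ a # b # ys) + t (xs @ a # b # ys) =
    - ((-1) ^ (ip a * ip b)) * (s (xs @ b # a # ys) + t (xs @ b # a # ys))" for xs a b ys
    using skewD[OF assms(1), of xs a b ys] skewD[OF assms(2), of xs a b ys]
    by (simp add: distrib_left)
qed

lemma skew_sum: "(\<And>j. j \<in> F \<Longrightarrow> skew (h j)) \<Longrightarrow> skew (\<lambda>w. \<Sum>j\<in>F. h j w)"
proof (induction F rule: infinite_finite_induct)
  case (insert j F)
  then show ?case by (simp add: skew_add)
qed (simp_all add: skew_def)

subsection \<open>Exterior multiplication of a tensor by a vector\<close>

text \<open>\<open>ins i v t\<close> is \<open>v \<otimes> t\<close> with the basis vectors of \<open>v\<close> moved to position \<open>i\<close>, each transposition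
  on the way contributing the sign prescribed by the exterior relations. So all the \<open>ins i v t\<close> are
  congruent, and \<open>wedge v t\<close> represents \<open>k + 1\<close> times \<open>v \<and> t\<close> for \<open>t\<close> of degree \<open>k\<close>.\<close>

definition ins :: "nat \<Rightarrow> ('i \<Rightarrow> 'a) \<Rightarrow> ('i list \<Rightarrow> 'a) \<Rightarrow> 'i list \<Rightarrow> 'a" where
  "ins i v t w = (if i < length w then (-1) ^ (i + ip (w ! i) * wp (take i w)) *
    (v (w ! i) * twist A (ip (w ! i)) (t (take i w @ drop (Suc i) w))) else 0)"

definition wedge :: "('i \<Rightarrow> 'a) \<Rightarrow> ('i list \<Rightarrow> 'a) \<Rightarrow> 'i list \<Rightarrow> 'a" where
  "wedge v t w = (\<Sum>i<length w. ins i v t w)"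

lemma wedge_Nil [simp]: "wedge v t [] = 0"
  by (simp add: wedge_def)

text \<open>Either v lands on the first letter a, or it passes a. Passing costs a minus sign and
  \<open>(-1) ^ (ip a * ip b)\<close> for the basis vector of index b, which is absorbed into the
  coefficients of v.\<close>

lemma wedge_Cons:
  "wedge v t (a # w) = v a * twist A (ip a) (t w) -
    wedge (\<lambda>b. (-1) ^ (ip a * ip b) * v b) (\<lambda>x. t (a # x)) w"
proof -
  have "ins (Suc i) v t (a # w) = - ins i (\<lambda>b. (-1) ^ (ip a * ip b) * v b) (\<lambda>x. t (a # x)) w" for i
    by (auto simp: ins_def minus_one_power_iff distrib_left)
  moreover have "ins 0 v t (a # w) = v a * twist A (ip a) (t w)"
    by (simp add: ins_def)
  ultimately show ?thesis
    by (simp add: wedge_def sum.lessThan_Suc_shift sum_negf del: sum.lessThan_Suc)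
qed

lemma ins_tensor_power: "t \<in> tensor_power n \<Longrightarrow> ins i v t \<in> tensor_power (Suc n)"
  by (auto simp: tensor_power_def ins_def)

text \<open>Moving v by one position is a single exchange of adjacent letters, and the steps
  telescope.\<close>

lemma ins_congruent:
  assumes t: "t \<in> tensor_power n" and i: "i \<le> n"
  shows "(\<lambda>w. ins 0 v t w - ins i v t w) \<in> I"
  using i
proof (induction i)
  case (Suc i)
  have "(\<lambda>w. ins i v t w - ins (Suc i) v t w) \<in> I"
  proof (rule swap_congruent[OF ins_tensor_power ins_tensor_power])
    show "ins (Suc i) v t (x @ b # a # y) = - ((-1) ^ (ip a * ip b)) * ins i v t (x @ a # b # y)"
      if "length x = i" for x a b y
      using that by (simp add: ins_def nth_append minus_one_power_iff distrib_left)
  qed (use t Suc in auto)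
  from I_add[OF this Suc.IH] Suc.prems show ?case by (simp add: algebra_simps)
qed simp

lemma wedge_tensor_power: "t \<in> tensor_power n \<Longrightarrow> wedge v t \<in> tensor_power (Suc n)"
  using ins_tensor_power[of t n] by (auto simp: tensor_power_def wedge_def)

lemma wedge_congruent:
  assumes t: "t \<in> tensor_power n"
  shows "(\<lambda>w. of_nat (Suc n) * (tensor_of_vector v \<otimes>\<^bsub>TA\<^esub> t) w - wedge v t w) \<in> I"
proof -
  have "(\<lambda>w. \<Sum>i<Suc n. ins 0 v t w - ins i v t w) \<in> I"
    by (rule I_sum) (use ins_congruent[OF t] in auto)
  moreover have "(\<Sum>i<Suc n. ins 0 v t w - ins i v t w) =
    of_nat (Suc n) * (tensor_of_vector v \<otimes>\<^bsub>TA\<^esub> t) w - wedge v t w" for w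
  proof (cases "length w = Suc n")
    case True
    then obtain a x where "w = a # x" by (auto simp: length_Suc_conv)
    then have "ins 0 v t w = (tensor_of_vector v \<otimes>\<^bsub>TA\<^esub> t) w"
      by (simp add: ins_def)
    then show ?thesis using True by (simp add: sum_subtractf wedge_def del: sum.lessThan_Suc)
  next
    case False
    then have "(tensor_of_vector v \<otimes>\<^bsub>TA\<^esub> t) w = 0"
      using t by (cases w) (auto simp: tensor_power_def)
    then show ?thesis
      using False ins_tensor_power[OF t] wedge_tensor_power[OF t]
      by (simp add: tensor_power_def del: sum.lessThan_Suc)
  qed
  ultimately show ?thesis by simp
qed

lemma wedge_neg_right: "wedge v (\<lambda>w. - t w) x = - wedge v t x"
  by (simp add: wedge_def ins_def sum_negf[symmetric] if_distrib[of uminus] cong: if_cong)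

lemma wedge_sign_right: "wedge v (\<lambda>w. (-1) ^ n * t w) x = (-1) ^ n * wedge v t x"
  by (cases "even n") (simp_all add: wedge_neg_right)

lemma wedge_skew:
  assumes "skew t"
  shows "skew (wedge v t)"
proof (rule skewI)
  fix xs a b ys
  show "wedge v t (xs @ a # b # ys) = - ((-1) ^ (ip a * ip b)) * wedge v t (xs @ b # a # ys)"
    using assms
  proof (induction xs arbitrary: v t)
    case Nil
    \<comment> \<open>With the tail rewritten by skewness of t, the terms in which v avoids both
      letters match. The terms with v on a and on b change roles under the exchange.\<close>
    have "(\<lambda>x. t (a # b # x)) = (\<lambda>x. (-1) ^ Suc (ip a * ip b) * t (b # a # x))"
      using skewD[OF Nil, of "[]" a b] by auto
    then show ?case
      by (simp add: wedge_Cons wedge_sign_right)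
        (simp add: wedge_sign_right wedge_neg_right twist_sign index_parity_def minus_one_power_iff mult.commute)
  next
    case (Cons x xs)
    show ?case
      using skewD[OF Cons.prems, of xs a b ys] Cons.IH[OF skew_Cons[OF Cons.prems, of x]]
      by (simp add: wedge_Cons minus_one_power_iff)
  qed
qed

lemma wedge_scale_left: "wedge (\<lambda>a. c * v a) t w = c * wedge v t w"
  unfolding wedge_def ins_def sum_distrib_left
  by (rule sum.cong) (auto simp: minus_one_power_iff mult.assoc)

lemma wedge_sum_left: "wedge (\<lambda>a. \<Sum>j\<in>F. v j a) t w = (\<Sum>j\<in>F. wedge (v j) t w)"
  unfolding wedge_def by (subst sum.swap) (auto simp: ins_def sum_distrib_left sum_distrib_right)

lemma wedge_sum_right: "wedge v (\<lambda>w. \<Sum>j\<in>F. t j w) w = (\<Sum>j\<in>F. wedge v (t j) w)"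
  unfolding wedge_def by (subst sum.swap) (auto simp: ins_def sum_distrib_left twist_sum)

lemma wedge_scale_right:
  assumes "r \<in> A 0"
  shows "wedge v (\<lambda>w. r * t w) w = r * wedge v t w"
proof -
  have "v a * (r * x) = r * (v a * x)" for a x
    using even_central[OF assms, of "v a"] by (metis mult.assoc)
  then show ?thesis
    unfolding wedge_def ins_def sum_distrib_left
    by (intro sum.cong) (auto simp: minus_one_power_iff twist_mult twist_even[OF assms])
qed

lemma wedge_zero_right [simp]: "wedge v (\<lambda>w. 0) w = 0"
  by (simp add: wedge_def ins_def)

text \<open>Arbitrary parity is allowed because the skew-symmetrization of a single basis tensor may
  be odd.\<close>

definition hom_tensor :: "nat \<Rightarrow> ('i list \<Rightarrow> 'a) \<Rightarrow> bool" where
  "hom_tensor q t \<longleftrightarrow> (\<forall>w. t w \<in> A (q + wp w))"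

lemma even_tensor_iff: "even_tensor A Od t \<longleftrightarrow> hom_tensor 0 t"
  by (simp add: even_tensor_def hom_tensor_def)

lemma twist_in: "x \<in> A q \<Longrightarrow> twist A p x \<in> A q"
  by (simp add: twist_homogeneous A_sign)

lemma wedge_hom_tensor:
  assumes v: "homogeneous A Od p v" and t: "hom_tensor q t"
  shows "hom_tensor (p + q) (wedge v t)"
  unfolding hom_tensor_def wedge_def
proof (intro allI A_sum)
  fix w :: "'i list" and i assume "i \<in> {..<length w}"
  then have i: "i < length w" by simp
  let ?a = "w ! i" and ?r = "take i w @ drop (Suc i) w"
  have "wp w = wp (take i w @ ?a # drop (Suc i) w)"
    by (simp add: id_take_nth_drop[OF i, symmetric])
  then have w: "wp w = ip ?a + wp ?r" by simp
  have "v ?a * twist A (ip ?a) (t ?r) \<in> A ((p + ip ?a) + (q + wp ?r))"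
    using v t by (intro mult_homogeneous twist_in) (simp_all add: homogeneous_def hom_tensor_def del: wp_simps)
  then have "v ?a * twist A (ip ?a) (t ?r) \<in> A (p + q + wp w)"
    using w by (simp add: ac_simps)
  then show "ins i v t w \<in> A (p + q + wp w)"
    by (simp add: ins_def A_sign)
qed

subsection \<open>Skew-symmetrization\<close>

text \<open>Skew-symmetrization of one basis tensor, built letter by letter instead of by summing
  over permutations. The successive divisors multiply to the factorial of the length.\<close>

primrec sk :: "'i list \<Rightarrow> 'i list \<Rightarrow> 'a" where
  "sk [] = mon []"
| "sk (a # w) = (\<lambda>x. (1 / real (Suc (length w))) *\<^sub>R wedge (\<lambda>c. if c = a then 1 else 0) (sk w) x)"

lemma sk_tensor_power: "sk w \<in> tensor_power (length w)"
proof (induction w)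
  case (Cons a w)
  from wedge_tensor_power[OF this] show ?case by (simp add: tensor_power_def)
qed (simp add: tensor_power_def mon_def)

lemma sk_skew: "skew (sk w)"
  by (induction w) (simp_all add: skew_scaleR wedge_skew, simp add: skew_def mon_def)

lemma sk_hom: "hom_tensor (wp w) (sk w)"
proof (induction w)
  case Nil
  then show ?case using one_even by (simp add: hom_tensor_def mon_def)
next
  case (Cons a w)
  from wedge_hom_tensor[OF homogeneous_basis_vector this, of a]
  show ?case by (simp add: hom_tensor_def A_scaleR)
qed

lemma I_scaleR: "t \<in> I \<Longrightarrow> (\<lambda>w. c *\<^sub>R t w) \<in> I"
  using I_scale[of t "of_real c"] by (simp add: scaleR_conv_of_real)

lemma sk_congruent: "(\<lambda>x. mon w x - sk w x) \<in> I"
proof (induction w)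
  case (Cons a w)
  let ?e = "\<lambda>c. if c = a then 1 else 0 :: 'a" and ?n = "length w"
  have "(\<lambda>x. (tensor_of_vector ?e \<otimes>\<^bsub>TA\<^esub> (\<lambda>x. mon w x - sk w x)) x +
      (1 / real (Suc ?n)) *\<^sub>R (of_nat (Suc ?n) * (tensor_of_vector ?e \<otimes>\<^bsub>TA\<^esub> sk w) x - wedge ?e (sk w) x)) \<in> I"
    by (intro I_add I_l_closed Cons.IH tensor_of_vector_carrier I_scaleR wedge_congruent sk_tensor_power)
  moreover have "(tensor_of_vector ?e \<otimes>\<^bsub>TA\<^esub> (\<lambda>x. mon w x - sk w x)) x +
      (1 / real (Suc ?n)) *\<^sub>R (of_nat (Suc ?n) * (tensor_of_vector ?e \<otimes>\<^bsub>TA\<^esub> sk w) x - wedge ?e (sk w) x)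
      = mon (a # w) x - sk (a # w) x" for x
  proof -
    have "(tensor_of_vector ?e \<otimes>\<^bsub>TA\<^esub> (\<lambda>x. mon w x - sk w x)) x =
      mon (a # w) x - (tensor_of_vector ?e \<otimes>\<^bsub>TA\<^esub> sk w) x"
      by (cases x) (auto simp: twist_diff mon_def)
    then show ?thesis
      unfolding scaleR_diff_right scaleR_of_nat_Suc by simp
  qed
  ultimately show ?case by simp
qed simp

text \<open>Expand t in basis tensors and skew-symmetrize each. The parity of a word enters twice,
  through its coefficient and through \<open>sk\<close>, so the result is even.\<close>

lemma skew_representative:
  assumes t: "t \<in> tensor_power k" "even_tensor A Od t"
  shows "\<exists>s \<in> tensor_power k. even_tensor A Od s \<and> skew s \<and> (\<lambda>w. t w - s w) \<in> I"
proof
  let ?s = "\<lambda>x. \<Sum>w | length w = k. t w * sk w x"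
  show "?s \<in> tensor_power k"
    using sk_tensor_power by (auto simp: tensor_power_def intro!: sum.neutral)
  have "even_tensor A Od ?s"
    unfolding even_tensor_def
  proof (intro allI A_sum)
    fix w x :: "'i list"
    have "t w * sk w x \<in> A (wp w + (wp w + wp x))"
      using t sk_hom by (intro mult_homogeneous) (auto simp: even_tensor_def hom_tensor_def)
    moreover have "A (wp w + (wp w + wp x)) = A (wp x)" by (rule A_cong) auto
    ultimately show "t w * sk w x \<in> A (wp x)" by (simp only:)
  qed
  moreover have "skew ?s"
    by (intro skew_sum skew_scale sk_skew)
  moreover have "(\<lambda>x. \<Sum>w | length w = k. t w * (mon w x - sk w x)) \<in> I"
    by (intro I_sum I_scale sk_congruent)
  moreover have "(\<Sum>w | length w = k. t w * (mon w x - sk w x)) = t x - ?s x" for x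
  proof -
    have "(\<Sum>w | length w = k. t w * mon w x) = (\<Sum>w | length w = k. if w = x then t x else 0)"
      by (rule sum.cong) (auto simp: mon_def)
    also have "\<dots> = t x" using t(1) by (auto simp: tensor_power_def)
    finally show ?thesis by (simp add: right_diff_distrib sum_subtractf)
  qed
  ultimately show "even_tensor A Od ?s \<and> skew ?s \<and> (\<lambda>w. t w - ?s w) \<in> I" by simp
qed

subsection \<open>Classes in the exterior algebra\<close>

lemma tensor_class_eq_iff:
  assumes "s \<in> carrier TA" "t \<in> carrier TA"
  shows "tensor_class A Od s = tensor_class A Od t \<longleftrightarrow> (\<lambda>w. s w - t w) \<in> I"
  using TA.quotient_eq_iff_same_a_r_cos[OF ideal_I assms] TA_minus[OF assms]
  by (simp add: tensor_class_def I_def)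

lemma vector_class_mult:
  assumes "t \<in> carrier TA"
  shows "vector_class A Od v \<otimes>\<^bsub>exterior_algebra A Od\<^esub> tensor_class A Od t =
    tensor_class A Od (tensor_of_vector v \<otimes>\<^bsub>TA\<^esub> t)"
  using ideal.rcoset_mult_add[OF ideal_I tensor_of_vector_carrier assms]
  by (simp add: exterior_algebra_def tensor_class_def FactRing_def I_def)

lemma tensor_class_zero_iff:
  assumes "t \<in> carrier TA"
  shows "tensor_class A Od t = \<zero>\<^bsub>exterior_algebra A Od\<^esub> \<longleftrightarrow> t \<in> I"
  using ideal.rcos_const_imp_mem[OF ideal_I assms] TA.a_rcos_zero[OF ideal_I, of t]
  by (auto simp: exterior_algebra_def tensor_class_def FactRing_def I_def)

text \<open>Two skew representatives differ by a skew element of the ideal, which is 0 by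
  \<open>skew_I_eq_0\<close>. This makes the definite description in \<open>components\<close>
  meaningful.\<close>

lemma components_tensor_class:
  assumes "t \<in> tensor_power k" "even_tensor A Od t" "skew t"
  shows "components A Od k (tensor_class A Od t) = t"
  unfolding components_def
proof (rule the_equality)
  show "t \<in> tensor_power k \<and> even_tensor A Od t \<and>
    (\<forall>xs a b ys. t (xs @ a # b # ys) = - ((-1) ^ (ip a * ip b)) * t (xs @ b # a # ys)) \<and>
    tensor_class A Od t = tensor_class A Od t"
    using assms skewD[OF assms(3)] by blast
  fix s assume s: "s \<in> tensor_power k \<and> even_tensor A Od s \<and>
    (\<forall>xs a b ys. s (xs @ a # b # ys) = - ((-1) ^ (ip a * ip b)) * s (xs @ b # a # ys)) \<and>
    tensor_class A Od t = tensor_class A Od s"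
  then have "(\<lambda>w. t w - s w) \<in> I"
    using tensor_class_eq_iff assms(1) tensor_power_carrier by blast
  moreover have "skew s" using s by (intro skewI) blast
  then have "skew (\<lambda>w. t w - s w)"
    using skew_add[OF assms(3) skew_scale[of s "-1"]] by simp
  ultimately show "s = t" using skew_I_eq_0 by fastforce
qed

text \<open>Modulo the ideal, \<open>wedge v t\<close> is k + 1 times the product, and k + 1 is
  invertible. Being skew, \<open>wedge v t\<close> lies in the ideal only if it is 0.\<close>

lemma vector_class_mult_zero_iff:
  assumes t: "t \<in> tensor_power k" and "skew t"
  shows "vector_class A Od v \<otimes>\<^bsub>exterior_algebra A Od\<^esub> tensor_class A Od t =
    \<zero>\<^bsub>exterior_algebra A Od\<^esub> \<longleftrightarrow> (\<forall>w. wedge v t w = 0)"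
proof -
  let ?m = "tensor_of_vector v \<otimes>\<^bsub>TA\<^esub> t"
  have tc: "t \<in> carrier TA" using t by (rule tensor_power_carrier)
  have m: "?m \<in> carrier TA" using tc by (intro TA_carrier_mult) auto
  note c = wedge_congruent[OF t, of v]
  have "?m \<in> I \<longleftrightarrow> (\<forall>w. wedge v t w = 0)"
  proof
    assume "?m \<in> I"
    from I_add[OF I_scale[OF c, of "-1"] I_scale[OF this, of "of_nat (Suc k)"]]
    have "wedge v t \<in> I" by simp
    then show "\<forall>w. wedge v t w = 0" using skew_I_eq_0 wedge_skew[OF assms(2)] by blast
  next
    assume "\<forall>w. wedge v t w = 0"
    from I_scaleR[OF c, of "1 / real (Suc k)"] this
    show "?m \<in> I"
      unfolding scaleR_diff_right scaleR_of_nat_Suc by simp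
  qed
  then show ?thesis using vector_class_mult[OF tc] tensor_class_zero_iff[OF m] by simp
qed

subsection \<open>Even words\<close>

lemma skew_move_to_front:
  assumes "skew t" "a \<notin> Od"
  shows "t (xs @ a # ys) = (-1) ^ length xs * t (a # xs @ ys)"
  using assms(1)
proof (induction xs arbitrary: t)
  case (Cons x xs)
  from Cons.IH[OF skew_Cons[OF Cons.prems, of x]] skewD[OF Cons.prems, of "[]" x a "xs @ ys"]
  show ?case by (simp add: ip_even[OF assms(2)])
qed simp

text \<open>The sign is left unspecified: for invertibility and vanishing it is irrelevant, and
  elsewhere it is carried along as a named exponent.\<close>

lemma skew_permute:
  assumes "skew t" "set w \<subseteq> - Od" "mset w = mset w'"
  shows "\<exists>n. t w = (-1) ^ n * t w'"
  using assms
proof (induction w arbitrary: t w')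
  case (Cons a w)
  have "a \<in> set w'" using Cons.prems(3) by (metis list.set_intros(1) set_mset_mset)
  then obtain xs ys where w': "w' = xs @ a # ys" by (meson split_list)
  then have "mset w = mset (xs @ ys)" using Cons.prems(3) by simp
  from Cons.IH[OF skew_Cons[OF Cons.prems(1), of a] _ this] Cons.prems(2)
  obtain n where "t (a # w) = (-1) ^ n * t (a # xs @ ys)" by auto
  moreover have "t w' = (-1) ^ length xs * t (a # xs @ ys)"
    unfolding w' using Cons.prems by (intro skew_move_to_front) auto
  ultimately have "t (a # w) = (-1) ^ (n + length xs) * t w'"
    by (simp add: minus_one_power_iff)
  then show ?case ..
qed (auto intro: exI[of _ 0])

text \<open>Two equal even letters are moved to the front, where exchanging them shows that twice
  the value is 0; real scalars allow halving.\<close>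

lemma skew_repeated:
  fixes t :: "'i list \<Rightarrow> 'a"
  assumes "skew t" "set w \<subseteq> - Od" "\<not> distinct w"
  shows "t w = 0"
proof -
  obtain xs ys zs a where w: "w = xs @ [a] @ ys @ [a] @ zs"
    using not_distinct_decomp[OF assms(3)] by blast
  then have "mset w = mset (a # a # xs @ ys @ zs)" by simp
  from skew_permute[OF assms(1,2) this] obtain n
    where n: "t w = (-1) ^ n * t (a # a # xs @ ys @ zs)" ..
  have "ip a = 0" using assms(2) w by (intro ip_even) auto
  then have "t (a # a # xs @ ys @ zs) + t (a # a # xs @ ys @ zs) = 0"
    using skewD[OF assms(1), of "[]" a a "xs @ ys @ zs"] by (simp add: eq_neg_iff_add_eq_0)
  then have "2 *\<^sub>R t (a # a # xs @ ys @ zs) = 0" by (simp add: scaleR_2)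
  then show ?thesis using n by simp
qed

subsection \<open>Products of vectors\<close>

abbreviation "wedges us t \<equiv> foldr wedge us t"
abbreviation "tensors us t \<equiv> foldr (\<lambda>u t. tensor_of_vector u \<otimes>\<^bsub>TA\<^esub> t) us t"

lemma mon_Nil_tensor_power [simp]: "mon [] \<in> tensor_power 0"
  by (simp add: tensor_power_def mon_def)

lemma skew_mon_Nil [simp]: "skew (mon [])"
  by (simp add: skew_def mon_def)

lemma hom_tensor_mon_Nil [simp]: "hom_tensor 0 (mon [])"
  using one_even by (simp add: hom_tensor_def mon_def)

lemma wedges_tensor_power: "t \<in> tensor_power n \<Longrightarrow> wedges us t \<in> tensor_power (length us + n)"
  by (induction us) (auto intro: wedge_tensor_power)

lemma wedges_skew: "skew t \<Longrightarrow> skew (wedges us t)"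
  by (induction us) (auto intro: wedge_skew)

lemma wedges_hom_tensor:
  "\<forall>u\<in>set us. homogeneous A Od 0 u \<Longrightarrow> hom_tensor q t \<Longrightarrow> hom_tensor q (wedges us t)"
proof (induction us)
  case (Cons u us)
  then show ?case using wedge_hom_tensor[of 0 u q "wedges us t"] by simp
qed simp

lemma wedges_scale:
  assumes "r \<in> A 0"
  shows "wedges us (\<lambda>w. r * t w) = (\<lambda>w. r * wedges us t w)"
  by (induction us) (auto simp: wedge_scale_right[OF assms])

lemma tensors_carrier: "t \<in> carrier TA \<Longrightarrow> tensors us t \<in> carrier TA"
  by (induction us) (auto intro: TA_carrier_mult)

lemma wedge_list_eq: "wedge_list A Od us = tensor_class A Od (tensors us (mon []))"
proof (induction us)
  case Nil
  then show ?case
    by (simp add: wedge_list_def tensor_class_def exterior_algebra_def FactRing_def one_TA_mon)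
next
  case (Cons u us)
  then show ?case
    using vector_class_mult[OF tensors_carrier[OF mon_carrier], of u us "[]"]
    by (simp add: wedge_list_def)
qed

lemma of_nat_even: "of_nat n \<in> A 0"
  using A_scaleR[OF one_even, of "real n"] by (simp add: scaleR_conv_of_real)

lemma fact_even: "fact n \<in> A 0"
  using of_nat_even[of "fact n"] by simp

lemma TA_mult_scale_right:
  assumes "r \<in> A 0"
  shows "s \<otimes>\<^bsub>TA\<^esub> (\<lambda>w. r * t w) = (\<lambda>w. r * (s \<otimes>\<^bsub>TA\<^esub> t) w)"
proof -
  have "x * (r * y) = r * (x * y)" for x y
    using even_central[OF assms, of x] by (metis mult.assoc)
  then show ?thesis
    by (simp add: TA_simps sum_distrib_left twist_mult twist_even[OF assms])
qed

text \<open>Each further vector contributes one factor from \<open>wedge_congruent\<close>; together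
  they give the factorial.\<close>

lemma wedges_congruent:
  assumes t: "t \<in> tensor_power 0"
  shows "(\<lambda>w. fact (length us) * tensors us t w - wedges us t w) \<in> I"
proof (induction us)
  case (Cons u us)
  let ?n = "length us" and ?X = "tensors us t" and ?Y = "wedges us t"
  let ?u = "tensor_of_vector u"
  have "(\<lambda>w. of_nat (Suc ?n) * (?u \<otimes>\<^bsub>TA\<^esub> (\<lambda>w. fact ?n * ?X w - ?Y w)) w +
      (of_nat (Suc ?n) * (?u \<otimes>\<^bsub>TA\<^esub> ?Y) w - wedge u ?Y w)) \<in> I"
    using wedges_tensor_power[OF t, of us]
    by (intro I_add I_scale I_l_closed Cons.IH tensor_of_vector_carrier wedge_congruent) simp
  moreover have "?u \<otimes>\<^bsub>TA\<^esub> (\<lambda>w. fact ?n * ?X w - ?Y w) =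
      (\<lambda>w. fact ?n * (?u \<otimes>\<^bsub>TA\<^esub> ?X) w - (?u \<otimes>\<^bsub>TA\<^esub> ?Y) w)"
    using TA_mult_add_right[of ?u "\<lambda>w. fact ?n * ?X w" "\<lambda>w. (-1) * ?Y w"]
      TA_mult_scale_right[OF fact_even, of ?u ?n ?X] TA_mult_scale_right[OF A_minus[OF one_even], of ?u ?Y]
    by simp
  ultimately show ?case
    by (simp add: right_diff_distrib mult.assoc del: of_nat_Suc)
qed simp

text \<open>The vector u anticommutes past the factors until it meets its copy, where twice its
  square lies in the ideal.\<close>

lemma tensors_repeated_I:
  assumes "u \<in> set us" "\<forall>v\<in>set us. homogeneous A Od 0 v"
  shows "tensor_of_vector u \<otimes>\<^bsub>TA\<^esub> tensors us (mon []) \<in> I"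
  using assms
proof (induction us)
  case (Cons v us)
  let ?u = "tensor_of_vector u" and ?v = "tensor_of_vector v" and ?X = "tensors us (mon [])"
  have X: "?X \<in> carrier TA" by (simp add: tensors_carrier)
  have "homogeneous A Od 0 u" "homogeneous A Od 0 v" using Cons.prems by auto
  then have "(\<lambda>x. (?u \<otimes>\<^bsub>TA\<^esub> ?v) x + (-1) ^ (0 * 0) * (?v \<otimes>\<^bsub>TA\<^esub> ?u) x) \<in> exterior_relations A Od"
    unfolding exterior_relations_def by blast
  then have "(\<lambda>x. (?u \<otimes>\<^bsub>TA\<^esub> ?v) x + (?v \<otimes>\<^bsub>TA\<^esub> ?u) x) \<in> I"
    unfolding I_def exterior_ideal_def using TA.genideal_self[OF exterior_relations_carrier] by auto
  from I_r_closed[OF this X]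
  have R: "(\<lambda>x. (?u \<otimes>\<^bsub>TA\<^esub> (?v \<otimes>\<^bsub>TA\<^esub> ?X)) x + (?v \<otimes>\<^bsub>TA\<^esub> (?u \<otimes>\<^bsub>TA\<^esub> ?X)) x) \<in> I"
    unfolding TA_mult_add_left TA_mult_assoc .
  show ?case
  proof (cases "u = v")
    case True
    then show ?thesis using I_scaleR[OF R, of "1/2"] by (simp add: scaleR_add_right[symmetric] scaleR_2[symmetric])
  next
    case False
    then have "?u \<otimes>\<^bsub>TA\<^esub> ?X \<in> I" using Cons by auto
    then have "?v \<otimes>\<^bsub>TA\<^esub> (?u \<otimes>\<^bsub>TA\<^esub> ?X) \<in> I"
      by (rule I_l_closed[OF _ tensor_of_vector_carrier])
    from I_add[OF R I_scale[OF this, of "-1"]] show ?thesis by simp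
  qed
qed simp

subsection \<open>Contraction with covectors\<close>

text \<open>Contraction in the first slot, restricted to indices in C. It is applied to even indices
  with even coefficients, so it carries no signs.\<close>

definition contract :: "'i set \<Rightarrow> ('i \<Rightarrow> 'a) \<Rightarrow> ('i list \<Rightarrow> 'a) \<Rightarrow> 'i list \<Rightarrow> 'a" where
  "contract C p t = (\<lambda>w. \<Sum>a\<in>C. p a * t (a # w))"

text \<open>The antiderivation rule for contraction with an even covector.\<close>

lemma contract_wedge:
  assumes C: "C \<subseteq> - Od" and p: "\<forall>a\<in>C. p a \<in> A 0"
  shows "contract C p (wedge u t) w = (\<Sum>a\<in>C. p a * u a) * t w - wedge u (contract C p t) w"
proof -
  have "p a * wedge u t (a # w) = p a * u a * t w - wedge u (\<lambda>x. p a * t (a # x)) w" if "a \<in> C" for a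
    using that C p wedge_scale_right[of "p a" u "\<lambda>x. t (a # x)" w] ip_even[of a]
    by (auto simp: wedge_Cons right_diff_distrib mult.assoc)
  then show ?thesis
    by (simp add: contract_def sum_subtractf sum_distrib_right wedge_sum_right)
qed

lemma contract_wedges_zero:
  assumes C: "C \<subseteq> - Od" and p: "\<forall>a\<in>C. p a \<in> A 0"
    and "\<forall>u\<in>set us. (\<Sum>a\<in>C. p a * u a) = 0"
  shows "contract C p (wedges us (mon [])) = (\<lambda>w. 0)"
  using assms(3)
proof (induction us)
  case Nil
  then show ?case by (simp add: contract_def mon_def)
next
  case (Cons u us)
  then show ?case by (auto simp: contract_wedge[OF C p])
qed

text \<open>By duality the covector \<open>p i\<close> kills all factors after \<open>u i\<close>,
  so contracting with it just removes \<open>u i\<close>.\<close>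

lemma contract_wedges_dual:
  assumes C: "C \<subseteq> - Od" and p: "\<forall>i<k. \<forall>a\<in>C. p i a \<in> A 0"
    and dual: "\<forall>i<k. \<forall>j<k. (\<Sum>a\<in>C. p i a * u j a) = (if i = j then 1 else 0)"
    and "i \<le> k"
  shows "fold (contract C) (map p [i..<k]) (wedges (map u [i..<k]) (mon [])) = mon []"
  using assms(4)
proof (induction rule: inc_induct)
  case (step i)
  have "contract C (p i) (wedges (map u [Suc i..<k]) (mon [])) = (\<lambda>w. 0)"
    using step p dual by (intro contract_wedges_zero C) auto
  then have "contract C (p i) (wedge (u i) (wedges (map u [Suc i..<k]) (mon []))) =
      wedges (map u [Suc i..<k]) (mon [])"
    using step p dual by (auto simp: contract_wedge[OF C])
  then show ?case using step by (simp add: upt_conv_Cons)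
qed simp

text \<open>Iterated contraction is a linear combination of components on words in C; its even
  coefficients commute with the common factor z.\<close>

lemma fold_contract_multiple:
  assumes "\<forall>p\<in>set ps. \<forall>a\<in>C. p a \<in> A 0"
    and "\<And>x. length x = length ps \<Longrightarrow> set x \<subseteq> C \<Longrightarrow> \<exists>y. t (x @ w) = z * y"
  shows "\<exists>y. fold (contract C) ps t w = z * y"
  using assms
proof (induction ps arbitrary: t)
  case (Cons p ps)
  have "\<exists>y. contract C p t (x @ w) = z * y" if x: "length x = length ps" "set x \<subseteq> C" for x
  proof -
    have "\<forall>a\<in>C. \<exists>y. t (a # x @ w) = z * y"
      using Cons.prems(2)[of "a # x" for a] x by auto
    then obtain y where y: "\<forall>a\<in>C. t (a # x @ w) = z * y a" by metis
    have "p a * (z * y a) = z * (p a * y a)" if "a \<in> C" for a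
      using Cons.prems(1) even_central[of "p a" z] that by (metis list.set_intros(1) mult.assoc)
    then have "contract C p t (x @ w) = z * (\<Sum>a\<in>C. p a * y a)"
      using y by (simp add: contract_def sum_distrib_left)
    then show ?thesis ..
  qed
  then show ?case using Cons.IH[of "contract C p t"] Cons.prems(1) by simp
qed (use assms(2)[of "[]"] in auto)

lemma wedges_invertible_component:
  assumes u: "\<forall>i<k. homogeneous A Od 0 (u i)" and ind: "independent_vectors Od k u"
  shows "\<exists>w. length w = k \<and> set w \<subseteq> - Od \<and> invertible_element (wedges (map u [0..<k]) (mon []) w)"
proof -
  let ?S = "wedges (map u [0..<k]) (mon [])"
  obtain C N where C: "finite C" "C \<subseteq> - Od" "card C = k"
    and N: "\<forall>i\<in>{..<k}. \<forall>j\<in>{..<k}. (\<Sum>a\<in>C. u i a * N a j) = (if i = j then 1 else 0)"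
    using ind unfolding independent_vectors_def invertible_matrix_def by blast
  have uC: "u i a \<in> A 0" if "i < k" "a \<in> C" for i a
  proof -
    have "u i a \<in> A (0 + ip a)" using u that by (simp add: homogeneous_def)
    then show ?thesis using ip_even[of a] C(2) that by auto
  qed
  \<comment> \<open>The entries of the inverse matrix are not assumed even. Their even components
    satisfy the same duality relations, because the entries \<open>u i a\<close> with a in C are
    even.\<close>
  define p where "p j a = even_component A (N a j)" for j a
  have dual: "(\<Sum>a\<in>C. p j a * u i a) = (if j = i then 1 else 0)" if "i < k" "j < k" for i j
  proof -
    have "(\<Sum>a\<in>C. p j a * u i a) = (\<Sum>a\<in>C. even_component A (u i a * N a j))"
    proof (rule sum.cong)
      fix a assume "a \<in> C"
      from uC[OF that(1) this] show "p j a * u i a = even_component A (u i a * N a j)"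
        unfolding p_def using even_component_mult_even even_central by metis
    qed simp
    also have "\<dots> = even_component A (if i = j then 1 else 0)"
      using N that by (simp add: even_component_sum[symmetric])
    finally show ?thesis by (simp add: even_component_even one_even)
  qed
  obtain cs where cs: "set cs = C" "distinct cs" using finite_distinct_list[OF C(1)] by blast
  have len: "length cs = k" using cs C(3) distinct_card by force
  have skew: "skew ?S" by (simp add: wedges_skew)
  \<comment> \<open>A word of length k in C either repeats a letter, so its component is 0, or
    permutes \<open>cs\<close>, so its component is that of \<open>cs\<close> up to sign.\<close>
  have "\<exists>y. fold (contract C) (map p [0..<k]) ?S [] = ?S cs * y"
  proof (rule fold_contract_multiple)
    fix x assume x: "length x = length (map p [0..<k])" "set x \<subseteq> C"
    show "\<exists>y. ?S (x @ []) = ?S cs * y"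
    proof (cases "distinct x")
      case True
      then have "set x = set cs"
        using x cs C by (metis card_subset_eq distinct_card length_map length_upt diff_zero)
      then have "mset x = mset cs" using True cs set_eq_iff_mset_eq_distinct by blast
      from skew_permute[OF skew _ this] x C obtain n where "?S x = (-1) ^ n * ?S cs" by auto
      then show ?thesis by (metis append_Nil2 minus_one_power_commute)
    next
      case False
      then show ?thesis using skew_repeated[OF skew _ False] x C by (auto intro: exI[of _ 0])
    qed
  qed (auto simp: p_def even_component_in)
  then obtain y where y: "?S cs * y = 1"
    using contract_wedges_dual[of C k p u 0] C dual
    by (auto simp: p_def even_component_in mon_def)
  have "hom_tensor 0 ?S" using u by (intro wedges_hom_tensor) auto
  then have "?S cs \<in> A 0" using C cs wp_even[of cs] by (auto simp: hom_tensor_def dest: spec[of _ cs])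
  then have "invertible_element (?S cs)"
    using y even_central[of "?S cs" y] by (auto simp: invertible_element_def)
  then show ?thesis using C cs len by blast
qed

subsection \<open>The associated space\<close>

text \<open>Counterpart of \<open>wedge_Cons\<close> at the other end: the last term has v on the
  letter b, after passing all of x.\<close>

lemma wedge_snoc:
  "wedge v t (x @ [b]) = wedge v (\<lambda>w. t (w @ [b])) x +
    (-1) ^ (length x + ip b * wp x) * (v b * twist A (ip b) (t x))"
proof (induction x arbitrary: v t)
  case (Cons a x)
  show ?case
    by (auto simp: wedge_Cons Cons minus_one_power_iff distrib_left)
qed (simp add: wedge_Cons)

text \<open>Removing a letter a from x lowers the parity of the word by \<open>ip a\<close>, and
  twisting y by \<open>ip a\<close> restores the missing sign. Thus y can be pulled out on the
  right.\<close>

lemma wedge_mult_right: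
  assumes "y \<in> A p"
  shows "wedge v (\<lambda>w. (-1) ^ (p * wp w) * (t w * y)) x = (-1) ^ (p * wp x) * (wedge v t x * y)"
proof -
  have "ins i v (\<lambda>w. (-1) ^ (p * wp w) * (t w * y)) x = (-1) ^ (p * wp x) * (ins i v t x * y)"
    if i: "i < length x" for i
  proof -
    let ?a = "x ! i" and ?r = "take i x @ drop (Suc i) x"
    have "wp x = wp (take i x @ ?a # drop (Suc i) x)"
      by (simp add: id_take_nth_drop[OF i, symmetric])
    then have w: "wp x = ip ?a + wp ?r" by simp
    show ?thesis
      unfolding ins_def w
      using i by (simp add: twist_sign twist_mult twist_homogeneous[OF assms] del: wp_simps)
        (auto simp: minus_one_power_iff mult.assoc)
  qed
  then show ?thesis by (simp add: wedge_def sum_distrib_left sum_distrib_right)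
qed

text \<open>In every term one of the vectors occupies the last slot. The coefficients depend on x
  only, so apart from the sign for b passing x the last slot is a fixed combination of the
  vectors.\<close>

lemma wedges_snoc:
  assumes "\<forall>u\<in>set us. homogeneous A Od 0 u"
  shows "\<exists>c. \<forall>x b. wedges us (mon []) (x @ [b]) =
    (-1) ^ (ip b * wp x) * (\<Sum>j<length us. c j x * (us ! j) b)"
  using assms
proof (induction us)
  case Nil
  then show ?case by (simp add: mon_def)
next
  case (Cons u us)
  let ?S = "wedges us (mon [])"
  obtain c where c: "\<And>x b. ?S (x @ [b]) = (-1) ^ (ip b * wp x) * (\<Sum>j<length us. c j x * (us ! j) b)"
    using Cons by auto
  \<comment> \<open>Index 0 collects the term with the new vector u on the last letter; the others
    keep an old vector there and insert u further left.\<close>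
  define d where "d j x = (case j of 0 \<Rightarrow> (-1) ^ length x * ?S x | Suc j \<Rightarrow> wedge u (c j) x)" for j x
  have "wedge u ?S (x @ [b]) = (-1) ^ (ip b * wp x) * (\<Sum>j<Suc (length us). d j x * ((u # us) ! j) b)" for x b
  proof -
    have ev: "v b \<in> A (ip b)" if "v \<in> set (u # us)" for v
      using Cons.prems that by (force simp: homogeneous_def)
    have S: "?S x \<in> A (wp x)"
      using wedges_hom_tensor[OF _ hom_tensor_mon_Nil, of us] Cons.prems by (simp add: hom_tensor_def)
    have "wedge u (\<lambda>w. ?S (w @ [b])) x =
        (\<Sum>j<length us. wedge u (\<lambda>w. (-1) ^ (ip b * wp w) * (c j w * (us ! j) b)) x)"
      by (simp add: c sum_distrib_left wedge_sum_right)
    also have "\<dots> = (-1) ^ (ip b * wp x) * (\<Sum>j<length us. wedge u (c j) x * (us ! j) b)"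
      using wedge_mult_right[OF ev] by (simp add: sum_distrib_left)
    moreover have "u b * twist A (ip b) (?S x) = ?S x * u b"
      using supercommute[OF ev S, of u] by (simp add: twist_homogeneous[OF S] minus_one_power_iff)
    ultimately show ?thesis
      unfolding wedge_snoc
      by (simp add: sum.lessThan_Suc_shift d_def minus_one_power_iff distrib_left del: sum.lessThan_Suc)
  qed
  then show ?case by auto
qed

text \<open>The parity r of the last covector produces no sign, since no letters follow it.\<close>

lemma tensor_eval_last:
  "tensor_eval Od (Suc n) t (q(n := r)) (p(n := l)) =
    (\<Sum>a\<in>UNIV. (\<Sum>x | length x = n. t (x @ [a]) * ((\<Prod>i\<leftarrow>[0..<n]. p i (x ! i)) * l a) *
      (-1) ^ (\<Sum>i<n. q i * (wp (drop (Suc i) x) + ip a))))"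
  unfolding tensor_eval_def sum_words_snoc
proof (intro sum.cong refl)
  fix a and x :: "'i list" assume "x \<in> {x. length x = n}"
  then have n: "length x = n" by simp
  have m: "map (\<lambda>i. (p(n := l)) i ((x @ [a]) ! i)) [0..<Suc n] = map (\<lambda>i. p i (x ! i)) [0..<n] @ [l a]"
    using n by (auto simp: nth_append)
  have "(\<Prod>i\<leftarrow>[0..<Suc n]. (p(n := l)) i ((x @ [a]) ! i)) = (\<Prod>i\<leftarrow>[0..<n]. p i (x ! i)) * l a"
    unfolding m by simp
  moreover have "(\<Sum>i<Suc n. (q(n := r)) i * wp (drop (Suc i) (x @ [a]))) =
      (\<Sum>i<n. q i * (wp (drop (Suc i) x) + ip a))"
    using n by simp
  ultimately show "t (x @ [a]) * (\<Prod>i\<leftarrow>[0..<Suc n]. (p(n := l)) i ((x @ [a]) ! i)) *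
      (-1) ^ (\<Sum>i<Suc n. (q(n := r)) i * wp (drop (Suc i) (x @ [a]))) =
    t (x @ [a]) * ((\<Prod>i\<leftarrow>[0..<n]. p i (x ! i)) * l a) *
      (-1) ^ (\<Sum>i<n. q i * (wp (drop (Suc i) x) + ip a))"
    by (simp only:)
qed

text \<open>Testing the defining identity on basis covectors, which are homogeneous, reads off each
  coefficient of v.\<close>

lemma contraction_components:
  assumes "v \<in> contractions A Od (Suc n) T"
  obtains q p where "\<forall>i<n. homogeneous A Od (q i) (p i)"
    and "\<And>b. v b = (\<Sum>x | length x = n. components A Od (Suc n) T (x @ [b]) * (\<Prod>i\<leftarrow>[0..<n]. p i (x ! i)) *
      (-1) ^ (\<Sum>i<n. q i * (wp (drop (Suc i) x) + ip b)))"
proof -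
  from assms obtain q p where qp: "\<forall>i<n. homogeneous A Od (q i) (p i)"
    and v: "\<And>r l. homogeneous A Od r l \<Longrightarrow> (\<Sum>a\<in>UNIV. v a * l a) =
      tensor_eval Od (Suc n) (components A Od (Suc n) T) (q(n := r)) (p(n := l))"
    unfolding contractions_def by auto
  have "v b = (\<Sum>x | length x = n. components A Od (Suc n) T (x @ [b]) * (\<Prod>i\<leftarrow>[0..<n]. p i (x ! i)) *
      (-1) ^ (\<Sum>i<n. q i * (wp (drop (Suc i) x) + ip b)))" for b
  proof -
    let ?t = "components A Od (Suc n) T" and ?e = "\<lambda>c. if c = b then 1 else 0 :: 'a"
    have "v b = (\<Sum>a\<in>UNIV. v a * ?e a)" by (simp add: if_distrib cong: if_cong)
    also have "\<dots> = (\<Sum>a\<in>UNIV. if a = b then (\<Sum>x | length x = n. ?t (x @ [b]) * (\<Prod>i\<leftarrow>[0..<n]. p i (x ! i)) *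
      (-1) ^ (\<Sum>i<n. q i * (wp (drop (Suc i) x) + ip b))) else 0)"
      unfolding v[OF homogeneous_basis_vector] tensor_eval_last by (rule sum.cong) auto
    finally show ?thesis by simp
  qed
  with qp that show ?thesis by blast
qed

lemma prod_list_in:
  assumes "\<forall>i<n. homogeneous A Od (q i) (p i)" "length x = n"
  shows "(\<Prod>i\<leftarrow>[0..<n]. p i (x ! i)) \<in> A ((\<Sum>i<n. q i) + wp x)"
proof -
  have "(\<Prod>i\<leftarrow>[0..<n]. p i (x ! i)) \<in> A (\<Sum>i\<leftarrow>[0..<n]. q i + ip (x ! i))"
    using assms by (intro A_prod_list) (auto simp: homogeneous_def)
  moreover have "(\<Sum>i\<leftarrow>[0..<n]. q i + ip (x ! i)) = (\<Sum>i<n. q i) + wp x"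
    using assms(2)
    by (simp add: interv_sum_list_conv_sum_set_nat sum.distrib word_parity_def sum_list_sum_nth atLeast0LessThan)
  ultimately show ?thesis by simp
qed

lemma contraction_in_span:
  assumes us: "\<forall>u\<in>set us. homogeneous A Od 0 u" and len: "length us = Suc n"
    and t: "components A Od (Suc n) T = (\<lambda>w. c *\<^sub>R wedges us (mon []) w)"
    and v: "v \<in> contractions A Od (Suc n) T"
  shows "\<exists>d. v = (\<lambda>b. \<Sum>j<Suc n. d j * (us ! j) b)"
proof -
  obtain e where e: "\<And>x b. wedges us (mon []) (x @ [b]) =
    (-1) ^ (ip b * wp x) * (\<Sum>j<Suc n. e j x * (us ! j) b)"
    using wedges_snoc[OF us] len by auto
  from v obtain q p where qp: "\<forall>i<n. homogeneous A Od (q i) (p i)"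
    and v: "\<And>b. v b = (\<Sum>x | length x = n. components A Od (Suc n) T (x @ [b]) * (\<Prod>i\<leftarrow>[0..<n]. p i (x ! i)) *
      (-1) ^ (\<Sum>i<n. q i * (wp (drop (Suc i) x) + ip b)))"
    using contraction_components by blast
  define P where "P x = (\<Prod>i\<leftarrow>[0..<n]. p i (x ! i))" for x
  define Q where "Q = (\<Sum>i<n. q i)"
  define E where "E x = (\<Sum>i<n. q i * wp (drop (Suc i) x))" for x
  define d where "d j = (\<Sum>x | length x = n. c *\<^sub>R ((-1) ^ E x * (e j x * P x)))" for j
  have "v b = (\<Sum>j<Suc n. d j * (us ! j) b)" for b
  proof -
    have summand: "components A Od (Suc n) T (x @ [b]) * P x * (-1) ^ (\<Sum>i<n. q i * (wp (drop (Suc i) x) + ip b)) =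
      (\<Sum>j<Suc n. c *\<^sub>R ((-1) ^ E x * (e j x * P x)) * (us ! j) b)" if x: "length x = n" for x
    proof -
      have ex: "(\<Sum>i<n. q i * (wp (drop (Suc i) x) + ip b)) = E x + ip b * Q"
        by (simp add: E_def Q_def sum.distrib distrib_left sum_distrib_left mult.commute)
      \<comment> \<open>Moving the vector coefficient to the right of the covector product cancels
        every sign that depends on b. Hence the coefficients \<open>d j\<close> do not depend on
        b.\<close>
      have "(us ! j) b * P x = (-1) ^ (ip b * (Q + wp x)) * (P x * (us ! j) b)" if "j < Suc n" for j
      proof (rule supercommute)
        show "(us ! j) b \<in> A (ip b)" using us len that by (force simp: homogeneous_def)
        show "P x \<in> A (Q + wp x)" unfolding P_def Q_def by (rule prod_list_in[OF qp x])
      qed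
      then have "(-1) ^ (ip b * wp x) * (e j x * (us ! j) b) * P x * (-1) ^ (E x + ip b * Q) =
          (-1) ^ E x * (e j x * P x) * (us ! j) b" if "j < Suc n" for j
        using that by (auto simp: mult.assoc minus_one_power_iff distrib_left)
      then show ?thesis
        unfolding ex t e
        by (simp add: sum_distrib_left sum_distrib_right scaleR_sum_right del: sum.lessThan_Suc)
    qed
    have "v b = (\<Sum>x | length x = n. \<Sum>j<Suc n. c *\<^sub>R ((-1) ^ E x * (e j x * P x)) * (us ! j) b)"
      unfolding v P_def[symmetric] by (intro sum.cong refl) (use summand in auto)
    also have "\<dots> = (\<Sum>j<Suc n. d j * (us ! j) b)"
      unfolding d_def sum_distrib_right by (rule sum.swap)
    finally show ?thesis .
  qed
  then show ?thesis by blast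
qed

lemma wedge_associated_space_zero:
  assumes "\<And>v. v \<in> contractions A Od k T \<Longrightarrow> wedge v t x = 0" "w \<in> associated_space A Od k T"
  shows "wedge w t x = 0"
proof -
  obtain c F where "w = (\<lambda>a. \<Sum>v\<in>F. c v * v a)" "F \<subseteq> contractions A Od k T"
    using assms(2) unfolding associated_space_def left_span_def by blast
  then show ?thesis
    using assms(1) by (auto simp: wedge_sum_left wedge_scale_left intro!: sum.neutral)
qed

lemma basis_prod_list:
  fixes d x :: "'i list"
  assumes "length d = n" "length x = n"
  shows "(\<Prod>i\<leftarrow>[0..<n]. if x ! i = d ! i then 1 else 0 :: 'a) = (if x = d then 1 else 0)"
proof (cases "x = d")
  case False
  then obtain i where i: "i < n" "x ! i \<noteq> d ! i" using assms nth_equalityI by metis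
  then have "0 \<in> set (map (\<lambda>i. if x ! i = d ! i then 1 else 0 :: 'a) [0..<n])"
    by (auto intro!: image_eqI[of _ _ i])
  then have "\<exists>ys zs. map (\<lambda>i. if x ! i = d ! i then 1 else 0 :: 'a) [0..<n] = ys @ 0 # zs"
    by (meson split_list)
  then show ?thesis using False by auto
next
  case True
  have "(\<Prod>i\<leftarrow>xs. 1 :: 'a) = 1" for xs :: "nat list" by (induction xs) auto
  then show ?thesis using True by simp
qed

text \<open>The covectors are dual to the letters of d; as these letters are even, all parities are
  0 and no signs occur.\<close>

lemma contraction_even_word:
  assumes d: "length d = n" "set d \<subseteq> - Od"
  shows "(\<lambda>b. components A Od (Suc n) T (d @ [b])) \<in> contractions A Od (Suc n) T"
proof -
  let ?t = "components A Od (Suc n) T"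
  define p where "p i = (\<lambda>c. if c = d ! i then 1 else 0 :: 'a)" for i
  have "homogeneous A Od 0 (p i)" if "i < n" for i
  proof -
    have "d ! i \<in> set d" using that d(1) by simp
    then have "ip (d ! i) = 0" using d(2) by (intro ip_even) auto
    then show ?thesis using homogeneous_basis_vector[of "d ! i"] by (simp add: p_def)
  qed
  moreover have "(\<Sum>a\<in>UNIV. ?t (d @ [a]) * l a) =
      tensor_eval Od (Suc n) ?t ((\<lambda>i. 0)(n := r)) (p(n := l))" for r l
  proof -
    have "(\<Sum>x | length x = n. ?t (x @ [a]) * ((\<Prod>i\<leftarrow>[0..<n]. p i (x ! i)) * l a)) = ?t (d @ [a]) * l a" for a
    proof -
      have "(\<Sum>x | length x = n. ?t (x @ [a]) * ((\<Prod>i\<leftarrow>[0..<n]. p i (x ! i)) * l a)) =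
        (\<Sum>x | length x = n. if x = d then ?t (d @ [a]) * l a else 0)"
        using basis_prod_list[OF d(1)] by (intro sum.cong) (auto simp: p_def)
      then show ?thesis using d(1) by simp
    qed
    then show ?thesis by (simp add: tensor_eval_last)
  qed
  ultimately show ?thesis
    unfolding contractions_def by (intro CollectI exI[of _ "\<lambda>i. 0"] exI[of _ p]) auto
qed

text \<open>Evaluating \<open>wedge (U c) t\<close> on words beginning with c expresses t as
  \<open>U c\<close> wedge its contraction with c. The other \<open>U c'\<close> vanish at c, so
  they still annihilate that contraction and the induction continues.\<close>

lemma expansion_along_vectors:
  assumes "distinct cs" "set cs \<subseteq> - Od"
    and "\<And>c c'. c \<in> set cs \<Longrightarrow> c' \<in> set cs \<Longrightarrow> U c c' = (if c = c' then 1 else 0)"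
    and "\<And>c w. c \<in> set cs \<Longrightarrow> wedge (U c) t w = 0"
  shows "t = wedges (map U cs) (\<lambda>w. t (cs @ w))"
  using assms
proof (induction cs arbitrary: t)
  case (Cons c cs)
  have c: "ip c = 0" using Cons.prems(2) by (intro ip_even) auto
  have *: "wedge (U c') t (c # w) = U c' c * t w - wedge (U c') (\<lambda>x. t (c # x)) w" for c' w
    by (simp add: wedge_Cons c)
  have "wedge (U c') (\<lambda>x. t (c # x)) w = 0" if "c' \<in> set cs" for c' w
  proof -
    have "U c' c = 0" using Cons.prems(1) Cons.prems(3)[of c' c] that by auto
    then show ?thesis using *[of c' w] Cons.prems(4)[of c' "c # w"] that by simp
  qed
  then have "(\<lambda>x. t (c # x)) = wedges (map U cs) (\<lambda>w. t (c # cs @ w))"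
    using Cons.prems by (intro Cons.IH) auto
  moreover have "t = wedge (U c) (\<lambda>x. t (c # x))"
  proof
    show "t w = wedge (U c) (\<lambda>x. t (c # x)) w" for w
      using *[of c w] Cons.prems(3)[of c c] Cons.prems(4)[of c "c # w"] by simp
  qed
  ultimately show ?case by simp
qed simp

lemma even_multivectors_representative:
  assumes "T \<in> even_multivectors A Od k"
  obtains t where "t \<in> tensor_power k" "even_tensor A Od t" "skew t"
    "T = tensor_class A Od t" "components A Od k T = t"
proof -
  obtain s where s: "s \<in> tensor_power k" "even_tensor A Od s" "T = tensor_class A Od s"
    using assms unfolding even_multivectors_def by blast
  obtain t where t: "t \<in> tensor_power k" "even_tensor A Od t" "skew t" "(\<lambda>w. s w - t w) \<in> I"
    using skew_representative[OF s(1,2)] by blast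
  then have "T = tensor_class A Od t"
    using s tensor_class_eq_iff tensor_power_carrier by blast
  with t components_tensor_class[OF t(1-3)] that show ?thesis by simp
qed

section \<open>A simple multivector is nondegenerate and annihilated by its associated space\<close>

lemma simple_multivector_imp:
  assumes simple: "simple_multivector A Od (Suc n) T"
  shows "nondegenerate A Od (Suc n) T"
    and "w \<in> associated_space A Od (Suc n) T \<Longrightarrow>
      vector_class A Od w \<otimes>\<^bsub>exterior_algebra A Od\<^esub> T = \<zero>\<^bsub>exterior_algebra A Od\<^esub>"
proof -
  let ?k = "Suc n"
  obtain u where u: "\<forall>i<?k. homogeneous A Od 0 (u i)" and ind: "independent_vectors Od ?k u"
    and T: "T = wedge_list A Od (map u [0..<?k])"
    using simple unfolding simple_multivector_def by blast
  define us where "us = map u [0..<?k]"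
  have us: "\<forall>v\<in>set us. homogeneous A Od 0 v" "length us = ?k"
    using u by (auto simp: us_def)
  let ?S = "wedges us (mon [])" and ?X = "tensors us (mon [])"
  define c where "c = inverse (fact ?k :: real)"
  have c: "c *\<^sub>R (fact ?k * x) = x" for x :: 'a
  proof -
    have "fact ?k * x = (fact ?k :: real) *\<^sub>R x"
      unfolding scaleR_conv_of_real of_real_fact ..
    moreover have "c * fact ?k = 1" unfolding c_def by (rule left_inverse) (rule fact_nonzero)
    ultimately show ?thesis by (simp del: fact_Suc)
  qed
  \<comment> \<open>\<open>wedges\<close> represents k! times the product, so this rescaled skew
    tensor is the one of T.\<close>
  define t where "t = (\<lambda>w. c *\<^sub>R ?S w)"
  have S: "?S \<in> tensor_power ?k" "skew ?S" "hom_tensor 0 ?S"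
    using wedges_tensor_power[OF mon_Nil_tensor_power, of us] us(2)
      wedges_skew[OF skew_mon_Nil] wedges_hom_tensor[OF us(1) hom_tensor_mon_Nil] by auto
  have t: "t \<in> tensor_power ?k" "skew t" "even_tensor A Od t"
    using S by (auto simp: t_def tensor_power_def skew_scaleR even_tensor_iff hom_tensor_def A_scaleR)
  have X: "?X \<in> carrier TA" by (simp add: tensors_carrier)
  have "(\<lambda>w. c *\<^sub>R (fact (length us) * ?X w - ?S w)) \<in> I"
    by (intro I_scaleR wedges_congruent mon_Nil_tensor_power)
  then have "(\<lambda>w. ?X w - t w) \<in> I"
    unfolding us(2) scaleR_diff_right c t_def .
  then have Tt: "T = tensor_class A Od t"
    using tensor_class_eq_iff[OF X tensor_power_carrier[OF t(1)]] T wedge_list_eq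
    unfolding us_def by simp
  have comp: "components A Od ?k T = t"
    unfolding Tt by (rule components_tensor_class[OF t(1,3,2)])
  show "nondegenerate A Od ?k T"
  proof -
    obtain cs y where cs: "length cs = ?k" "set cs \<subseteq> - Od" and y: "?S cs * y = 1" "y * ?S cs = 1"
      using wedges_invertible_component[OF u ind] unfolding invertible_element_def us_def by blast
    have "c \<noteq> 0" by (simp add: c_def)
    then have "t cs * (inverse c *\<^sub>R y) = 1" "(inverse c *\<^sub>R y) * t cs = 1"
      using y by (simp_all add: t_def)
    then show ?thesis
      using cs unfolding nondegenerate_def invertible_element_def comp by blast
  qed
  have zero: "wedge v t x = 0" if "v \<in> set us" for v x
  proof -
    have "tensor_of_vector v \<otimes>\<^bsub>TA\<^esub> ?X \<in> I"
      using tensors_repeated_I[OF that us(1)] .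
    moreover have "tensor_of_vector v \<otimes>\<^bsub>TA\<^esub> ?X \<in> carrier TA"
      using X by (intro TA_carrier_mult) auto
    ultimately have "vector_class A Od v \<otimes>\<^bsub>exterior_algebra A Od\<^esub> T = \<zero>\<^bsub>exterior_algebra A Od\<^esub>"
      using vector_class_mult[OF X, of v] tensor_class_zero_iff T wedge_list_eq[of us] by (simp add: us_def)
    then show ?thesis using vector_class_mult_zero_iff[OF t(1,2)] Tt by blast
  qed
  assume w: "w \<in> associated_space A Od ?k T"
  have "wedge w t x = 0" for x
  proof (rule wedge_associated_space_zero[OF _ w])
    fix v assume "v \<in> contractions A Od ?k T"
    from contraction_in_span[OF us comp[unfolded t_def] this]
    obtain d where "v = (\<lambda>b. \<Sum>j<?k. d j * (us ! j) b)" by blast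
    then show "wedge v t x = 0"
      using zero us(2) by (auto simp: wedge_sum_left wedge_scale_left simp del: sum.lessThan_Suc intro!: sum.neutral)
  qed
  then show "vector_class A Od w \<otimes>\<^bsub>exterior_algebra A Od\<^esub> T = \<zero>\<^bsub>exterior_algebra A Od\<^esub>"
    using vector_class_mult_zero_iff[OF t(1,2)] Tt by blast
qed

section \<open>Constructing a decomposition from an invertible component\<close>

lemma diagonal_independent:
  fixes us :: "('i \<Rightarrow> 'a) list"
  assumes cs: "distinct cs" "set cs \<subseteq> - Od" "length cs = k"
    and s: "\<And>i. i < k \<Longrightarrow> s i * s' i = 1" "\<And>i. i < k \<Longrightarrow> s' i * s i = (1 :: 'a)"
    and u: "\<And>i j. i < k \<Longrightarrow> j < k \<Longrightarrow> u i (cs ! j) = (if i = j then s i else 0)"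
  shows "independent_vectors Od k u"
proof -
  have sum_C: "(\<Sum>a\<in>set cs. f a) = (\<Sum>m<k. f (cs ! m))" for f :: "'i \<Rightarrow> 'a"
    using cs by (simp add: sum.distinct_set_conv_list sum_list_sum_nth atLeast0LessThan)
  \<comment> \<open>On the columns \<open>cs\<close> the matrix is diagonal, so the diagonal matrix
    of the inverses \<open>s' j\<close> inverts it.\<close>
  define N where "N a j = (if a = cs ! j then s' j else 0)" for a j
  have N: "N (cs ! m) j = (if m = j then s' j else 0)" if "m < k" "j < k" for m j
    using that cs by (auto simp: N_def nth_eq_iff_index_eq)
  have "invertible_matrix {..<k} (set cs) u"
    unfolding invertible_matrix_def
  proof (intro exI[of _ N] conjI ballI)
    fix i j assume ij: "i \<in> {..<k}" "j \<in> {..<k}"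
    have "(\<Sum>a\<in>set cs. u i a * N a j) = (\<Sum>m<k. if m = i then (if i = j then 1 else 0) else 0)"
      unfolding sum_C using ij s by (intro sum.cong) (auto simp: u N)
    then show "(\<Sum>a\<in>set cs. u i a * N a j) = (if i = j then 1 else 0)"
      using ij by simp
  next
    fix a b assume "a \<in> set cs" "b \<in> set cs"
    then obtain l m where lm: "l < k" "m < k" "a = cs ! l" "b = cs ! m"
      using cs(3) by (auto simp: in_set_conv_nth)
    have "(\<Sum>i<k. N a i * u i b) = (\<Sum>i<k. if i = l then (if l = m then 1 else 0) else 0)"
      using lm s by (intro sum.cong) (auto simp: u N)
    then show "(\<Sum>i<k. N a i * u i b) = (if a = b then 1 else 0)"
      using lm cs by (simp add: nth_eq_iff_index_eq)
  qed
  then show ?thesis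
    using cs distinct_card unfolding independent_vectors_def by (intro exI[of _ "set cs"]) auto
qed

lemma simple_multivectorI:
  assumes T: "T \<in> even_multivectors A Od (Suc n)" and nd: "nondegenerate A Od (Suc n) T"
    and zero: "\<And>w. w \<in> associated_space A Od (Suc n) T \<Longrightarrow>
      vector_class A Od w \<otimes>\<^bsub>exterior_algebra A Od\<^esub> T = \<zero>\<^bsub>exterior_algebra A Od\<^esub>"
  shows "simple_multivector A Od (Suc n) T"
proof -
  let ?k = "Suc n"
  obtain t where t: "t \<in> tensor_power ?k" "even_tensor A Od t" "skew t"
    and Tt: "T = tensor_class A Od t" and comp: "components A Od ?k T = t"
    using even_multivectors_representative[OF T] by blast
  obtain cs \<theta>' where cs: "length cs = ?k" "set cs \<subseteq> - Od"
    and \<theta>': "t cs * \<theta>' = 1" "\<theta>' * t cs = 1"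
    using nd unfolding nondegenerate_def invertible_element_def comp by blast
  have dist: "distinct cs"
    using skew_repeated[OF t(3) cs(2)] \<theta>' by fastforce
  have even0: "x \<in> A (wp w) \<Longrightarrow> set w \<subseteq> - Od \<Longrightarrow> x \<in> A 0" for x w
    by (simp add: wp_even)
  have \<theta>: "t cs \<in> A 0" using t(2) cs(2) even0 unfolding even_tensor_def by blast
  \<comment> \<open>The contraction of T with the basis covectors of all letters of
    \<open>cs\<close> except c. At c it gives the chosen component up to sign; at another letter of
    \<open>cs\<close> it has a repeated letter.\<close>
  define v where "v c = (\<lambda>b. t (remove1 c cs @ [b]))" for c
  have "\<exists>n. v c c = (-1) ^ n * t cs" if "c \<in> set cs" for c
  proof -
    have "mset (remove1 c cs @ [c]) = mset cs" using that by simp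
    moreover have "set (remove1 c cs @ [c]) \<subseteq> - Od" using that cs set_remove1_subset[of c cs] by auto
    ultimately show ?thesis unfolding v_def using skew_permute[OF t(3)] by blast
  qed
  then obtain e where e: "\<And>c. c \<in> set cs \<Longrightarrow> v c c = (-1) ^ e c * t cs" by metis
  have v0: "v c c' = 0" if "c \<in> set cs" "c' \<in> set cs" "c \<noteq> c'" for c c'
    unfolding v_def using that cs dist set_remove1_subset[of c cs]
    by (intro skew_repeated[OF t(3)]) auto
  define U where "U c = (\<lambda>b. ((-1) ^ e c * \<theta>') * v c b)" for c
  have U: "U c c' = (if c = c' then 1 else 0)" if "c \<in> set cs" "c' \<in> set cs" for c c'
    using that v0 \<theta>' by (auto simp: U_def e minus_one_power_iff)
  have U_even: "homogeneous A Od 0 (U c)" if "c \<in> set cs" for c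
    unfolding homogeneous_def
  proof
    fix b
    have "\<theta>' \<in> A 0" using inverse_even[OF \<theta> \<theta>'(1)] .
    then have "(-1) ^ e c * \<theta>' \<in> A 0" by (rule A_sign)
    moreover have "v c b \<in> A (ip b)"
      using t(2) cs wp_even[of "remove1 c cs"] set_remove1_subset[of c cs]
      by (auto simp: v_def even_tensor_def dest: spec[of _ "remove1 c cs @ [b]"])
    ultimately show "U c b \<in> A (0 + ip b)" unfolding U_def using mult_homogeneous by fastforce
  qed
  have wU: "wedge (U c) t w = 0" if c: "c \<in> set cs" for c w
  proof -
    have "v c \<in> contractions A Od ?k T"
      unfolding v_def comp[symmetric]
      using c cs set_remove1_subset[of c cs] by (intro contraction_even_word) (auto simp: length_remove1)
    then have "U c \<in> associated_space A Od ?k T"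
      unfolding associated_space_def left_span_def U_def
      by (intro CollectI exI[of _ "\<lambda>_. (-1) ^ e c * \<theta>'"] exI[of _ "{v c}"]) auto
    from zero[OF this] show ?thesis using vector_class_mult_zero_iff[OF t(1,3)] Tt by blast
  qed
  let ?us = "map U cs"
  have "t = wedges ?us (\<lambda>w. t (cs @ w))"
    using dist cs(2) U wU by (rule expansion_along_vectors)
  \<comment> \<open>The degree of t is the length of \<open>cs\<close>, so only the empty word can
    follow \<open>cs\<close>.\<close>
  also have "(\<lambda>w. t (cs @ w)) = (\<lambda>w. t cs * mon [] w)"
    using t(1) cs(1) by (auto simp: mon_def tensor_power_def)
  also have "wedges ?us (\<lambda>w. t cs * mon [] w) = (\<lambda>w. t cs * wedges ?us (mon []) w)"
    by (rule wedges_scale[OF \<theta>])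
  finally have t_eq: "t = (\<lambda>w. t cs * wedges ?us (mon []) w)" .
  \<comment> \<open>Passing from \<open>wedges\<close> to the actual product brings in k!. The total
    scalar \<eta> is even and invertible and is absorbed into the first vector, which exists because
    the degree is positive.\<close>
  define \<eta> where "\<eta> = t cs * fact ?k"
  define \<eta>' where "\<eta>' = inverse (fact ?k :: real) *\<^sub>R \<theta>'"
  have \<eta>: "\<eta> \<in> A 0" using mult_homogeneous[OF \<theta> fact_even, of ?k] by (simp add: \<eta>_def del: fact_Suc)
  have f: "(fact ?k :: 'a) = of_real (fact ?k)" by simp
  have "\<eta> = (fact ?k :: real) *\<^sub>R t cs"
    unfolding \<eta>_def f by (simp add: scaleR_conv_of_real even_central[OF \<theta>] del: fact_Suc of_real_fact)
  then have \<eta>_inv: "\<eta> * \<eta>' = 1" "\<eta>' * \<eta> = 1"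
    using \<theta>' by (simp_all add: \<eta>'_def del: fact_Suc)
  obtain c ds where cs_eq: "cs = c # ds" using cs(1) by (cases cs) auto
  define us where "us = (\<lambda>b. \<eta> * U c b) # map U ds"
  have "tensor_of_vector (\<lambda>b. \<eta> * U c b) = (\<lambda>w. \<eta> * tensor_of_vector (U c) w)"
    by (auto simp: tensor_of_vector_def split: list.split)
  then have X: "tensors us (mon []) = (\<lambda>w. \<eta> * tensors ?us (mon []) w)"
    by (simp add: us_def cs_eq TA_mult_scale_left)
  have "(\<lambda>w. t cs * (fact (length ?us) * tensors ?us (mon []) w - wedges ?us (mon []) w)) \<in> I"
    by (intro I_scale wedges_congruent mon_Nil_tensor_power)
  moreover have "t cs * (fact (length ?us) * tensors ?us (mon []) w - wedges ?us (mon []) w) =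
      tensors us (mon []) w - t w" for w
    using fun_cong[OF t_eq, of w] cs(1) by (simp add: X \<eta>_def right_diff_distrib mult.assoc del: fact_Suc)
  ultimately have "(\<lambda>w. tensors us (mon []) w - t w) \<in> I" by simp
  then have "tensor_class A Od (tensors us (mon [])) = tensor_class A Od t"
    using tensor_class_eq_iff[OF tensors_carrier[OF mon_carrier] tensor_power_carrier[OF t(1)]] by blast
  then have "T = wedge_list A Od us" by (simp add: Tt wedge_list_eq)
  moreover have len: "length us = ?k" using cs(1) by (simp add: us_def cs_eq)
  then have "map ((!) us) [0..<?k] = us" by (metis map_nth)
  moreover have "homogeneous A Od 0 (us ! i)" if "i < ?k" for i
  proof -
    have "homogeneous A Od 0 (\<lambda>b. \<eta> * U c b)"
      using U_even[of c] mult_homogeneous[OF \<eta>] unfolding homogeneous_def cs_eq by fastforce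
    then have "\<forall>u\<in>set us. homogeneous A Od 0 u" using U_even by (auto simp: us_def cs_eq)
    then show ?thesis using that len by simp
  qed
  moreover have "independent_vectors Od ?k ((!) us)"
  proof (rule diagonal_independent[OF dist cs(2,1)])
    show "(if i = 0 then \<eta> else 1) * (if i = 0 then \<eta>' else 1) = 1"
      "(if i = 0 then \<eta>' else 1) * (if i = 0 then \<eta> else 1) = 1" for i :: nat
      using \<eta>_inv by auto
    fix i j assume ij: "i < ?k" "j < ?k"
    have "us ! i = (\<lambda>b. (if i = 0 then \<eta> else 1) * U (cs ! i) b)"
      using ij(1) cs(1) by (cases i) (auto simp: us_def cs_eq)
    then show "(us ! i) (cs ! j) = (if i = j then (if i = 0 then \<eta> else 1) else 0)"
      using ij cs(1) dist U[of "cs ! i" "cs ! j"] by (simp add: nth_eq_iff_index_eq)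
  qed
  ultimately show ?thesis
    unfolding simple_multivector_def by (intro exI[of _ "(!) us"]) simp
qed

end

theorem theorem1:
  fixes A :: "nat \<Rightarrow> 'a::real_algebra_1 set"
    and Od :: "'i::finite set"
    and n m k :: nat
    and T :: "('i list \<Rightarrow> 'a) set"
  assumes "supercommutative_algebra A"
    and "card (- Od) = n" and "card Od = m"
    and "1 \<le> k" and "k \<le> n"
    and "T \<in> even_multivectors A Od k"
  shows "simple_multivector A Od k T \<longleftrightarrow>
    nondegenerate A Od k T \<and>
    (\<forall>w\<in>associated_space A Od k T.
      vector_class A Od w \<otimes>\<^bsub>exterior_algebra A Od\<^esub> T = \<zero>\<^bsub>exterior_algebra A Od\<^esub>)"
proof -
  interpret super_module A Od using assms(1) by (simp add: super_module_def)
  obtain l where "k = Suc l" using assms(4) by (cases k) auto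
  then show ?thesis using simple_multivector_imp simple_multivectorI assms(6) by metis
qed

end
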